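(* Let $V\ge2$, let $s$ be a probability distribution on $\{1,\dots,V\}$ with $s(V)>0$, and let $1=q_1<q_2<\dots<q_l=V$ be the values of $k$ for which $\mathrm{ev}_k$ is a supported efficient policy (equivalently, the abscissae of the vertices of the least concave majorant of the points $\{(k,S(k)):1\le k\le V\}$). Let $C'$ satisfy $q_i<C'\le q_{i+1}$ for some $i$, and write $C'=\gamma' q_i+(1-\gamma')q_{i+1}$ with $\gamma'\in[0,1)$. Then, in the relaxed buffer model under the LRU stack model with distribution $s$, the randomized mixture that, for every item and every lifetime independently, uses $\mathrm{ev}_{q_i}$ with probability $\gamma'$ and $\mathrm{ev}_{q_{i+1}}$ with probability $1-\gamma'$ achieves the minimum long-run miss rate among all policies whose long-run average buffer occupancy is $C'$.
   Context: $S(j)=\sum_{i\le j}s(i)$. LRU stack model: $V$ items; the LRU stack $\Lambda_t$ lists items in order of most recent access; next access $a_{t+1}=\Lambda_t(d_t)$ with $d_t$ i.i.d., $\Pr[d_t=j]=s(j)$; $\Lambda_{t+1}$ is obtained by moving $\Lambda_t(d_t)$ to the top and shifting positions $1,\dots,d_t-1$ down by one. Relaxed buffer model: the buffer has unlimited capacity; the accessed item must be in the buffer (it is brought in on a miss, i.e. when it was not in the buffer), and after each access any buffered item other than the one just accessed may be evicted. The two costs are the long-run miss rate and the long-run average number of buffered items (occupancy). A lifetime of an item is the time interval between two consecutive accesses to it; at the start of a lifetime the item is at the top of the LRU stack and in the buffer. The single-item policy $\mathrm{ev}_k$ keeps the item in the buffer while its LRU depth is at most $k$ and evicts it as soon as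 its depth exceeds $k$. A single-item policy is a supported efficient policy if its pair (occupancy, miss rate), which for $\mathrm{ev}_k$ equals $(k/V,(1-S(k))/V)$, is not dominated by any convex combination of the cost pairs of other policies. *)

theory Defs
  imports "HOL-Probability.Probability"
begin

text \<open>
  A stack is a list whose \<open>j\<close>-th position (counted from 1) is \<open>L ! (j - 1)\<close>. An item has LRU depth
  at most \<open>k\<close> iff it belongs to \<open>set (take k L)\<close>.
\<close>

definition move_to_top :: "nat \<Rightarrow> 'a list \<Rightarrow> 'a list" where
  "move_to_top j L = L ! (j - 1) # take (j - 1) L @ drop j L"

text \<open>The argument \<open>\<delta>\<close> is one realisation of the sequence of access depths.\<close>

primrec lru_stack :: "'a list \<Rightarrow> (nat \<Rightarrow> nat) \<Rightarrow> nat \<Rightarrow> 'a list" where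
  "lru_stack L0 \<delta> 0 = L0"
| "lru_stack L0 \<delta> (Suc t) = move_to_top (\<delta> t) (lru_stack L0 \<delta> t)"

text \<open>The item accessed between times \<open>t\<close> and \<open>t + 1\<close>, usually written with index \<open>t + 1\<close>.\<close>

definition next_access :: "'a list \<Rightarrow> (nat \<Rightarrow> nat) \<Rightarrow> nat \<Rightarrow> 'a" where
  "next_access L0 \<delta> t = lru_stack L0 \<delta> t ! (\<delta> t - 1)"

definition lru_depths :: "'w measure \<Rightarrow> nat pmf \<Rightarrow> (nat \<Rightarrow> 'w \<Rightarrow> nat) \<Rightarrow> bool" where
  "lru_depths M s d \<longleftrightarrow>
     prob_space.indep_vars M (\<lambda>_. count_space UNIV) d UNIV \<and>
     (\<forall>t. distr M (count_space UNIV) (d t) = measure_pmf s)"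

text \<open>
  A policy managing the items of \<open>A\<close> is represented by the process \<open>B\<close> of buffer contents that it
  produces; \<open>A\<close> is the set of all items for the buffer, and a singleton for a single-item policy.
  Evictions may depend on the whole past and on private randomness, but the next depth \<open>d t\<close> must be
  independent of the accesses and buffer contents up to time \<open>t\<close>, so that there is no look-ahead.
  The path conditions are required almost surely because the depths lie in the support of their
  distribution only almost surely.
\<close>

definition buffer_policy ::
  "'w measure \<Rightarrow> 'a list \<Rightarrow> (nat \<Rightarrow> 'w \<Rightarrow> nat) \<Rightarrow> 'a set \<Rightarrow> (nat \<Rightarrow> 'w \<Rightarrow> 'a set) \<Rightarrow> bool" where
  "buffer_policy M L0 d A B \<longleftrightarrow>
     (AE \<omega> in M. B 0 \<omega> \<subseteq> A \<and>
        (\<forall>t. {next_access L0 (\<lambda>u. d u \<omega>) t} \<inter> A \<subseteq> B (Suc t) \<omega> \<and>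
             B (Suc t) \<omega> \<subseteq> B t \<omega> \<union> ({next_access L0 (\<lambda>u. d u \<omega>) t} \<inter> A))) \<and>
     (\<forall>t. prob_space.indep_set M
        (sets (vimage_algebra (space M) (d t) (count_space UNIV)))
        (sets (vimage_algebra (space M)
          (\<lambda>\<omega>. (map (\<lambda>u. d u \<omega>) [0..<t], map (\<lambda>u. B u \<omega>) [0..<Suc t]))
          (count_space UNIV))))"

definition avg_occupancy :: "'w measure \<Rightarrow> (nat \<Rightarrow> 'w \<Rightarrow> 'a set) \<Rightarrow> nat \<Rightarrow> real" where
  "avg_occupancy M B T = (\<Sum>t<T. \<integral>\<omega>. real (card (B t \<omega>)) \<partial>M) / real T"

definition avg_misses ::
  "'w measure \<Rightarrow> 'a list \<Rightarrow> (nat \<Rightarrow> 'w \<Rightarrow> nat) \<Rightarrow> 'a set \<Rightarrow> (nat \<Rightarrow> 'w \<Rightarrow> 'a set) \<Rightarrow> nat \<Rightarrow> real" where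
  "avg_misses M L0 d A B T =
     (\<Sum>t<T. measure M {\<omega> \<in> space M. next_access L0 (\<lambda>u. d u \<omega>) t \<in> A - B t \<omega>}) / real T"

text \<open>The pair (long-run occupancy, long-run miss rate), as limits of expected time averages.\<close>

definition has_costs ::
  "'w measure \<Rightarrow> 'a list \<Rightarrow> (nat \<Rightarrow> 'w \<Rightarrow> nat) \<Rightarrow> 'a set \<Rightarrow> (nat \<Rightarrow> 'w \<Rightarrow> 'a set) \<Rightarrow>
    real \<times> real \<Rightarrow> bool" where
  "has_costs M L0 d A B c \<longleftrightarrow>
     avg_occupancy M B \<longlonglongrightarrow> fst c \<and> avg_misses M L0 d A B \<longlonglongrightarrow> snd c"

text \<open>The number of accesses to \<open>y\<close> up to time \<open>t\<close>, which serves as the index of its current lifetime.\<close>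

definition lifetime :: "'a list \<Rightarrow> (nat \<Rightarrow> nat) \<Rightarrow> nat \<Rightarrow> 'a \<Rightarrow> nat" where
  "lifetime L0 \<delta> t y = card {u. u < t \<and> next_access L0 \<delta> u = y}"

text \<open>
  Buffer contents, starting from an empty buffer, when item \<open>y\<close> of \<open>A\<close> follows the policy
  \<open>ev\<close> with threshold \<open>\<kappa> y n\<close> during its \<open>n\<close>-th lifetime.
\<close>

primrec ev_buffer ::
  "'a set \<Rightarrow> ('a \<Rightarrow> nat \<Rightarrow> nat) \<Rightarrow> 'a list \<Rightarrow> (nat \<Rightarrow> nat) \<Rightarrow> nat \<Rightarrow> 'a set" where
  "ev_buffer A \<kappa> L0 \<delta> 0 = {}"
| "ev_buffer A \<kappa> L0 \<delta> (Suc t) =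
     {y \<in> ev_buffer A \<kappa> L0 \<delta> t \<union> ({next_access L0 \<delta> t} \<inter> A).
        y \<in> set (take (\<kappa> y (lifetime L0 \<delta> (Suc t) y)) (lru_stack L0 \<delta> (Suc t)))}"

definition single_item_costs ::
  "'w measure \<Rightarrow> 'a list \<Rightarrow> (nat \<Rightarrow> 'w \<Rightarrow> nat) \<Rightarrow> 'a \<Rightarrow> (real \<times> real) set" where
  "single_item_costs M L0 d x =
     {c. \<exists>B. buffer_policy M L0 d {x} B \<and> has_costs M L0 d {x} B c}"

text \<open>
  Domination is weak and ``other policies'' are those with a different cost pair; hence a
  point that merely lies inside an edge of the efficient frontier is not supported efficient.
\<close>

definition supported_efficient ::
  "'w measure \<Rightarrow> 'a list \<Rightarrow> (nat \<Rightarrow> 'w \<Rightarrow> nat) \<Rightarrow> nat \<Rightarrow> bool" where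
  "supported_efficient M L0 d k \<longleftrightarrow>
     (\<forall>x \<in> set L0. \<exists>c.
        has_costs M L0 d {x} (\<lambda>t \<omega>. ev_buffer {x} (\<lambda>_ _. k) L0 (\<lambda>u. d u \<omega>) t) c \<and>
        \<not> (\<exists>p \<in> convex hull (single_item_costs M L0 d x - {c}).
              fst p \<le> fst c \<and> snd p \<le> snd c))"

text \<open>
  Independent coins, one for each item and each lifetime, that are also independent of the depths:
  threshold \<open>k\<close> with probability \<open>\<gamma>\<close> and \<open>k'\<close> otherwise.
\<close>

definition lifetime_coins ::
  "'w measure \<Rightarrow> 'a list \<Rightarrow> (nat \<Rightarrow> 'w \<Rightarrow> nat) \<Rightarrow> real \<Rightarrow> nat \<Rightarrow> nat \<Rightarrow>
    ('a \<Rightarrow> nat \<Rightarrow> 'w \<Rightarrow> nat) \<Rightarrow> bool" where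
  "lifetime_coins M L0 d \<gamma> k k' K \<longleftrightarrow>
     prob_space.indep_vars M (\<lambda>_. count_space UNIV)
       (case_sum d (\<lambda>(y, n). K y n)) (UNIV <+> set L0 \<times> UNIV) \<and>
     (\<forall>y \<in> set L0. \<forall>n. distr M (count_space UNIV) (K y n) =
        measure_pmf (map_pmf (\<lambda>b. if b then k else k') (bernoulli_pmf \<gamma>)))"

definition mixture_buffer ::
  "'a list \<Rightarrow> (nat \<Rightarrow> 'w \<Rightarrow> nat) \<Rightarrow> ('a \<Rightarrow> nat \<Rightarrow> 'w \<Rightarrow> nat) \<Rightarrow> nat \<Rightarrow> 'w \<Rightarrow> 'a set" where
  "mixture_buffer L0 d K t \<omega> =
     ev_buffer (set L0) (\<lambda>y n. K y n \<omega>) L0 (\<lambda>u. d u \<omega>) t"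

end

theory Submission
  imports Defs
begin

text \<open>
  Let \<open>x j\<close> be the long-run frequency with which the item at depth \<open>j\<close> is buffered. An item that is
  buffered at depth \<open>j + 1\<close> was buffered one step before at depth \<open>j + 1\<close> (access at depth at most \<open>j\<close>)
  or at depth \<open>j\<close> (deeper access). The next depth is independent of the past and is larger than \<open>j\<close>
  with positive probability because \<open>s(V) > 0\<close>; averaging over time gives \<open>x (j + 1) \<le> x j\<close>, and
  \<open>x 1 = 1\<close>. Occupancy is the sum of the \<open>x j\<close> and the hit rate is the sum of the \<open>s(j) x j\<close>, so
  summation by parts bounds hit rate minus \<open>\<mu>\<close> times occupancy by the maximum of \<open>S(k) - \<mu> k\<close>, for
  every \<open>\<mu>\<close>. The same argument for a single item shows that \<open>k\<close> is supported efficient as soon as it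
  maximises \<open>S(k) - \<mu> k\<close> for two different slopes. Hence consecutive supported efficient values span
  a supporting line of \<open>S\<close>, and the mixture, whose costs lie on that line, is optimal.
\<close>

subsection \<open>The LRU stack\<close>

lemma length_move_to_top [simp]:
  assumes "j \<in> {1..length L}"
  shows "length (move_to_top j L) = length L"
  using assms by (auto simp: move_to_top_def min_def)

lemma mset_move_to_top:
  assumes "j \<in> {1..length L}"
  shows "mset (move_to_top j L) = mset L"
proof -
  have "L = take (j - 1) L @ L ! (j - 1) # drop j L"
    using id_take_nth_drop[of "j - 1" L] assms by auto
  then have "mset L = mset (take (j - 1) L @ L ! (j - 1) # drop j L)" by argo
  then show ?thesis
    by (simp add: move_to_top_def)
qed

lemma move_to_top_nth_0 [simp]: "move_to_top j L ! 0 = L ! (j - 1)"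
  by (simp add: move_to_top_def)

lemma move_to_top_nth_Suc:
  assumes "j \<in> {1..length L}" "Suc i < length L"
  shows "move_to_top j L ! Suc i = (if Suc i < j then L ! i else L ! Suc i)"
  using assms by (auto simp: move_to_top_def nth_append min_def)

text \<open>Between two accesses the depth of an item never decreases.\<close>

lemma set_take_move_to_top:
  assumes "j \<in> {1..length L}" "y \<noteq> L ! (j - 1)" "y \<in> set (take k (move_to_top j L))"
  shows "y \<in> set (take k L)"
proof -
  obtain i where i: "i < k" "i < length L" "y = move_to_top j L ! i"
    using assms(1,3) by (auto simp: in_set_conv_nth)
  then obtain i' where "i = Suc i'"
    using assms(2) by (cases i) auto
  then show ?thesis
    using i assms(1) move_to_top_nth_Suc[of j L i']
    by (cases "Suc i' < j") (auto simp: in_set_conv_nth intro: exI[of _ i'] exI[of _ "Suc i'"])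
qed

lemma mset_lru_stack:
  assumes "\<And>u. \<delta> u \<in> {1..length L0}"
  shows "mset (lru_stack L0 \<delta> t) = mset L0"
proof (induction t)
  case (Suc t)
  then have "length (lru_stack L0 \<delta> t) = length L0"
    by (rule mset_eq_length)
  then show ?case
    using Suc assms[of t] by (simp add: mset_move_to_top)
qed simp

lemma lru_stack_perm:
  assumes "\<And>u. \<delta> u \<in> {1..length L0}"
  shows length_lru_stack: "length (lru_stack L0 \<delta> t) = length L0"
    and set_lru_stack: "set (lru_stack L0 \<delta> t) = set L0"
    and distinct_lru_stack: "distinct (lru_stack L0 \<delta> t) \<longleftrightarrow> distinct L0"
  using mset_lru_stack[of \<delta> L0 t] assms
  by (auto dest: mset_eq_length mset_eq_setD mset_eq_imp_distinct_iff)

text \<open>Causality, here and in the congruence rules below: a process at time \<open>t\<close> is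
  a function of finitely many depths, to which independence can be applied. The access with index
  \<open>t\<close> also reads the depth at \<open>t\<close>, unlike the stack.\<close>

lemma lru_stack_cong:
  "(\<And>u. u < t \<Longrightarrow> \<delta> u = \<delta>' u) \<Longrightarrow> lru_stack L0 \<delta> t = lru_stack L0 \<delta>' t"
  by (induction t) auto

lemma next_access_cong:
  "(\<And>u. u \<le> t \<Longrightarrow> \<delta> u = \<delta>' u) \<Longrightarrow> next_access L0 \<delta> t = next_access L0 \<delta>' t"
  unfolding next_access_def using lru_stack_cong[of t \<delta> \<delta>' L0] by auto

lemma lifetime_cong:
  assumes "\<And>u. u < t \<Longrightarrow> \<delta> u = \<delta>' u"
  shows "lifetime L0 \<delta> t = lifetime L0 \<delta>' t"
proof -
  have "next_access L0 \<delta> u = next_access L0 \<delta>' u" if "u < t" for u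
    using that assms by (intro next_access_cong) auto
  then show ?thesis
    unfolding lifetime_def by (auto intro!: arg_cong[of _ _ card])
qed

lemma ev_buffer_subset: "ev_buffer A \<kappa> L0 \<delta> t \<subseteq> A"
  by (induction t) auto

lemma lifetime_Suc:
  "lifetime L0 \<delta> (Suc t) y = lifetime L0 \<delta> t y + (if next_access L0 \<delta> t = y then 1 else 0)"
proof -
  have *: "{u. u < Suc t \<and> next_access L0 \<delta> u = y} =
    {u. u < t \<and> next_access L0 \<delta> u = y} \<union> (if next_access L0 \<delta> t = y then {t} else {})"
    by (auto simp: less_Suc_eq)
  then show ?thesis
    unfolding lifetime_def by (subst *, subst card_Un_disjoint) auto
qed

lemma lifetime_le: "lifetime L0 \<delta> t y \<le> t"
  by (induction t) (auto simp: lifetime_Suc lifetime_def[of _ _ 0])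

lemma lifetime_0 [simp]: "lifetime L0 \<delta> 0 y = 0"
  by (simp add: lifetime_def)

text \<open>Up to time \<open>t\<close> no item has begun a lifetime of index above
  \<open>t\<close>, so for a finite set of items only finitely many thresholds matter.\<close>

lemma ev_buffer_cong:
  assumes "\<And>u. u < t \<Longrightarrow> \<delta> u = \<delta>' u" "\<And>y n. y \<in> A \<Longrightarrow> n \<le> t \<Longrightarrow> \<kappa> y n = \<kappa>' y n"
  shows "ev_buffer A \<kappa> L0 \<delta> t = ev_buffer A \<kappa>' L0 \<delta>' t"
  using assms
proof (induction t)
  case (Suc t)
  have "lru_stack L0 \<delta> (Suc t) = lru_stack L0 \<delta>' (Suc t)"
    "next_access L0 \<delta> t = next_access L0 \<delta>' t"
    "lifetime L0 \<delta> (Suc t) = lifetime L0 \<delta>' (Suc t)"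
    using Suc.prems(1) by (intro lru_stack_cong next_access_cong lifetime_cong; simp)+
  moreover have "ev_buffer A \<kappa> L0 \<delta> t = ev_buffer A \<kappa>' L0 \<delta>' t"
    using Suc.prems by (intro Suc.IH) auto
  ultimately show ?case
    using Suc.prems(2) ev_buffer_subset[of A \<kappa>' L0 \<delta>' t] lifetime_le[of L0 \<delta>' "Suc t"]
    by (auto simp del: lru_stack.simps)
qed simp

text \<open>Between accesses the depth never decreases, so an item within its threshold now has been
  within it ever since its last access: the recursion collapses to a test of the current depth. The
  condition on the lifetime index reflects the empty initial buffer.\<close>

lemma mem_ev_buffer_iff:
  assumes "\<And>u. \<delta> u \<in> {1..length L0}"
  shows "y \<in> ev_buffer A \<kappa> L0 \<delta> t \<longleftrightarrow>
    y \<in> A \<and> 0 < lifetime L0 \<delta> t y \<and>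
    y \<in> set (take (\<kappa> y (lifetime L0 \<delta> t y)) (lru_stack L0 \<delta> t))"
proof (induction t)
  case (Suc t)
  show ?case
  proof (cases "next_access L0 \<delta> t = y")
    case True
    then show ?thesis by (auto simp: lifetime_Suc dest: ev_buffer_subset[THEN subsetD])
  next
    case False
    then have "y \<in> set (take k (lru_stack L0 \<delta> t))" if "y \<in> set (take k (lru_stack L0 \<delta> (Suc t)))" for k
      using that set_take_move_to_top[of "\<delta> t" "lru_stack L0 \<delta> t" y k] assms[of t]
        length_lru_stack[of \<delta> L0 t] assms
      by (auto simp: next_access_def)
    then show ?thesis
      using False Suc.IH by (auto simp: lifetime_Suc simp del: lru_stack.simps)
  qed
qed simp

subsection \<open>Summation and convexity\<close>

text \<open>Nonincreasing nonnegative weights \<open>y\<close> are a nonnegative combination of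
  indicators of prefixes with coefficients adding up to \<open>y 0\<close>, and each prefix sum of
  \<open>f\<close> is at most \<open>F\<close>.\<close>

lemma abel_summation_le:
  fixes f y :: "nat \<Rightarrow> real"
  assumes y: "\<And>j. Suc j < n \<Longrightarrow> y (Suc j) \<le> y j" "\<And>j. j < n \<Longrightarrow> 0 \<le> y j"
    and f: "\<And>k. k \<in> {1..n} \<Longrightarrow> (\<Sum>j<k. f j) \<le> F" and n: "0 < n"
  shows "(\<Sum>j<n. f j * y j) \<le> F * y 0"
proof -
  \<comment> \<open>The decrease of \<open>y\<close> up to index \<open>m\<close> is already charged
    at rate \<open>F\<close>, while the current prefix sum keeps its exact value with weight
    \<open>y m\<close>.\<close>
  have *: "(\<Sum>j<Suc m. f j * y j) \<le> F * (y 0 - y m) + (\<Sum>j<Suc m. f j) * y m" if "m < n" for m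
    using that
  proof (induction m)
    case (Suc m)
    have "(\<Sum>j<Suc m. f j) * (y m - y (Suc m)) \<le> F * (y m - y (Suc m))"
      using Suc.prems y(1)[of m] f[of "Suc m"] by (intro mult_right_mono) auto
    then show ?case
      using Suc by (simp add: algebra_simps)
  qed simp
  obtain m where m: "n = Suc m"
    using n by (cases n) auto
  then have "(\<Sum>j<n. f j) * y m \<le> F * y m"
    using y(2)[of m] f[of n] by (intro mult_right_mono) auto
  then show ?thesis
    using *[of m] m by (simp add: algebra_simps)
qed

lemma tendsto_div_bounded:
  fixes f :: "nat \<Rightarrow> real"
  assumes "\<And>n. \<bar>f n\<bar> \<le> c"
  shows "(\<lambda>n. f n / real n) \<longlonglongrightarrow> 0"
proof (rule Lim_null_comparison)
  show "\<forall>\<^sub>F n in sequentially. norm (f n / real n) \<le> c / real n"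
    using assms by (auto intro!: always_eventually divide_right_mono)
  show "(\<lambda>n. c / real n) \<longlonglongrightarrow> 0"
    by (rule lim_const_over_n)
qed

lemma sum_threshold:
  fixes f :: "nat \<Rightarrow> real"
  assumes "k \<le> n"
  shows "(\<Sum>j<n. f j * (if j < k then 1 else 0)) = (\<Sum>j<k. f j)"
proof -
  have "(\<Sum>j<n. f j * (if j < k then 1 else 0)) = (\<Sum>j | j \<in> {..<n} \<and> j < k. f j)"
    by (subst sum.inter_filter) (auto intro!: sum.cong)
  also have "{j. j \<in> {..<n} \<and> j < k} = {..<k}"
    using assms by auto
  finally show ?thesis .
qed

text \<open>A point lying on two supporting lines with distinct slopes is a vertex of the frontier.\<close>

lemma not_dominated_if_two_supporting_lines:
  fixes c :: "real \<times> real"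
  assumes "0 \<le> \<mu>" "\<mu> < \<mu>'"
    and "\<And>p. p \<in> C \<Longrightarrow> snd c + \<mu> * fst c \<le> snd p + \<mu> * fst p"
    and "\<And>p. p \<in> C \<Longrightarrow> snd c + \<mu>' * fst c \<le> snd p + \<mu>' * fst p"
  shows "\<not> (\<exists>p \<in> convex hull (C - {c}). fst p \<le> fst c \<and> snd p \<le> snd c)"
proof
  assume "\<exists>p \<in> convex hull (C - {c}). fst p \<le> fst c \<and> snd p \<le> snd c"
  then obtain p where p: "p \<in> convex hull (C - {c})" "fst p \<le> fst c" "snd p \<le> snd c"
    by blast
  \<comment> \<open>Twice the functional with the mean slope. On \<open>C\<close> it is minimal at
    \<open>c\<close>, and equality in it forces equality on both supporting lines, which meet only
    at \<open>c\<close>; hence the strict half-space.\<close>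
  let ?H = "{p. inner (\<mu> + \<mu>', 2) p > inner (\<mu> + \<mu>', 2) c}"
  have "C - {c} \<subseteq> ?H"
  proof
    fix x assume x: "x \<in> C - {c}"
    show "x \<in> ?H"
    proof (rule ccontr)
      assume "x \<notin> ?H"
      then have "(\<mu> + \<mu>') * fst x + 2 * snd x \<le> (\<mu> + \<mu>') * fst c + 2 * snd c"
        by (simp add: inner_prod_def)
      then have eq: "snd c + \<mu> * fst c = snd x + \<mu> * fst x" "snd c + \<mu>' * fst c = snd x + \<mu>' * fst x"
        using assms(3,4)[of x] x unfolding distrib_right by auto
      then have "(\<mu>' - \<mu>) * (fst c - fst x) = 0"
        by (simp add: algebra_simps)
      then have "fst c = fst x"
        using assms(2) by simp
      then show False
        using eq x by (auto simp: prod_eq_iff)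
    qed
  qed
  then have "convex hull (C - {c}) \<subseteq> ?H"
    by (intro hull_minimal convex_halfspace_gt) auto
  then have "(\<mu> + \<mu>') * fst c + 2 * snd c < (\<mu> + \<mu>') * fst p + 2 * snd p"
    using p by (auto simp: inner_prod_def)
  moreover have "(\<mu> + \<mu>') * fst p \<le> (\<mu> + \<mu>') * fst c"
    using assms p by (intro mult_left_mono) auto
  ultimately show False
    using p by linarith
qed

subsection \<open>Policies without look-ahead\<close>

text \<open>Finitely many coordinates with values in \<open>nat\<close> form a discrete product
  space, so arbitrary predicates of disjoint finite sets of coordinates are measurable and
  independent.\<close>

lemma (in prob_space) indep_vars_disjoint_functions:
  fixes X :: "'i \<Rightarrow> 'a \<Rightarrow> nat"
  assumes X: "indep_vars (\<lambda>_. count_space UNIV) X I"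
    and J: "finite J" "J \<subseteq> I" "finite J'" "J' \<subseteq> I" "J \<inter> J' = {}"
    and h: "\<And>x y :: 'i \<Rightarrow> nat. (\<And>j. j \<in> J \<Longrightarrow> x j = y j) \<Longrightarrow> h x \<longleftrightarrow> h y"
    and h': "\<And>x y. (\<And>j. j \<in> J' \<Longrightarrow> x j = y j) \<Longrightarrow> h' x \<longleftrightarrow> h' y"
  shows "{\<omega> \<in> space M. h' (\<lambda>j. X j \<omega>)} \<in> events \<and>
    prob {\<omega> \<in> space M. h (\<lambda>j. X j \<omega>) \<and> h' (\<lambda>j. X j \<omega>)} =
      prob {\<omega> \<in> space M. h (\<lambda>j. X j \<omega>)} * prob {\<omega> \<in> space M. h' (\<lambda>j. X j \<omega>)}"
proof -
  have "indep_var (PiM J (\<lambda>_. count_space UNIV)) (\<lambda>\<omega>. restrict (\<lambda>i. X i \<omega>) J)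
      (PiM J' (\<lambda>_. count_space UNIV)) (\<lambda>\<omega>. restrict (\<lambda>i. X i \<omega>) J')"
    using J by (intro indep_var_restrict[OF X]) auto
  then have "indep_var (count_space UNIV) (h \<circ> (\<lambda>\<omega>. restrict (\<lambda>i. X i \<omega>) J))
      (count_space UNIV) (h' \<circ> (\<lambda>\<omega>. restrict (\<lambda>i. X i \<omega>) J'))"
    by (rule indep_var_compose) (use J in \<open>auto simp: count_space_PiM_finite\<close>)
  also have "h \<circ> (\<lambda>\<omega>. restrict (\<lambda>i. X i \<omega>) J) = (\<lambda>\<omega>. h (\<lambda>j. X j \<omega>))"
    using h[of "restrict (\<lambda>i. X i \<omega>) J" "\<lambda>j. X j \<omega>" for \<omega>] by (simp add: fun_eq_iff)
  also have "h' \<circ> (\<lambda>\<omega>. restrict (\<lambda>i. X i \<omega>) J') = (\<lambda>\<omega>. h' (\<lambda>j. X j \<omega>))"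
    using h'[of "restrict (\<lambda>i. X i \<omega>) J'" "\<lambda>j. X j \<omega>" for \<omega>] by (simp add: fun_eq_iff)
  finally have ind: "indep_var (count_space UNIV) (\<lambda>\<omega>. h (\<lambda>j. X j \<omega>)) (count_space UNIV) (\<lambda>\<omega>. h' (\<lambda>j. X j \<omega>))" .
  have "prob {\<omega> \<in> space M. h (\<lambda>j. X j \<omega>) \<and> h' (\<lambda>j. X j \<omega>)} =
      prob ((\<lambda>\<omega>. (h (\<lambda>j. X j \<omega>), h' (\<lambda>j. X j \<omega>))) -` ({True} \<times> {True}) \<inter> space M)"
    by (intro arg_cong[of _ _ prob]) auto
  also have "\<dots> = prob {\<omega> \<in> space M. h (\<lambda>j. X j \<omega>)} * prob {\<omega> \<in> space M. h' (\<lambda>j. X j \<omega>)}"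
    by (subst indep_varD[OF ind])
      (auto simp: vimage_def Int_def conj_commute intro!: arg_cong2[of _ _ _ _ "(*)"] arg_cong[of _ _ prob])
  finally have "prob {\<omega> \<in> space M. h (\<lambda>j. X j \<omega>) \<and> h' (\<lambda>j. X j \<omega>)} =
      prob {\<omega> \<in> space M. h (\<lambda>j. X j \<omega>)} * prob {\<omega> \<in> space M. h' (\<lambda>j. X j \<omega>)}" .
  moreover have "(\<lambda>\<omega>. h' (\<lambda>j. X j \<omega>)) \<in> M \<rightarrow>\<^sub>M count_space UNIV"
    using ind by (simp add: indep_var_eq)
  from measurable_sets[OF this, of "{True}"]
  have "{\<omega> \<in> space M. h' (\<lambda>j. X j \<omega>)} \<in> events"
    by (simp add: vimage_def Int_def conj_commute)
  ultimately show ?thesis by blast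
qed

section \<open>The depth distribution and its cumulative sums\<close>

locale lru_model = prob_space M for M :: "'w measure" +
  fixes s :: "nat pmf" and L0 :: "'a list" and d :: "nat \<Rightarrow> 'w \<Rightarrow> nat"
  assumes support: "set_pmf s \<subseteq> {1..length L0}" and pmf_last_pos: "0 < pmf s (length L0)"
    and distinct_L0: "distinct L0" and depths: "lru_depths M s d"
begin

abbreviation V :: nat where "V \<equiv> length L0"

abbreviation S :: "nat \<Rightarrow> real" where "S k \<equiv> measure_pmf.prob s {..k}"

abbreviation stk :: "nat \<Rightarrow> 'w \<Rightarrow> 'a list" where
  "stk t \<omega> \<equiv> lru_stack L0 (\<lambda>u. d u \<omega>) t"

abbreviation acc :: "nat \<Rightarrow> 'w \<Rightarrow> 'a" where
  "acc t \<omega> \<equiv> next_access L0 (\<lambda>u. d u \<omega>) t"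

abbreviation past :: "nat \<Rightarrow> 'w \<Rightarrow> nat list" where
  "past t \<omega> \<equiv> map (\<lambda>u. d u \<omega>) [0..<t]"

lemma V_pos: "0 < V"
proof -
  have "V \<in> set_pmf s"
    using pmf_last_pos by (simp add: set_pmf_iff)
  then show ?thesis
    using support by auto
qed

lemma distr_depth: "distr M (count_space UNIV) (d t) = measure_pmf s"
  using depths by (simp add: lru_depths_def)

lemma measurable_depth [measurable]: "d t \<in> M \<rightarrow>\<^sub>M count_space UNIV"
  using depths unfolding lru_depths_def indep_vars_def by auto

lemma prob_depth: "prob {\<omega> \<in> space M. d t \<omega> \<in> D} = measure_pmf.prob s D"
proof -
  have "measure_pmf.prob s D = measure (distr M (count_space UNIV) (d t)) D"
    by (simp add: distr_depth)
  also have "\<dots> = prob {\<omega> \<in> space M. d t \<omega> \<in> D}"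
    by (subst measure_distr) (auto intro!: arg_cong[of _ _ prob])
  finally show ?thesis by simp
qed

lemma AE_depths: "AE \<omega> in M. \<forall>t. d t \<omega> \<in> {1..V}"
proof -
  have "AE \<omega> in M. d t \<omega> \<in> {1..V}" for t
  proof -
    have "AE k in distr M (count_space UNIV) (d t). k \<in> {1..V}"
      unfolding distr_depth using support by (intro AE_pmfI) blast
    then show ?thesis
      by (subst (asm) AE_distr_iff) auto
  qed
  then show ?thesis
    by (simp add: AE_all_countable del: atLeastAtMost_iff)
qed

lemma S_Suc: "S (Suc k) = S k + pmf s (Suc k)"
  by (simp add: atMost_Suc measure_pmf.finite_measure_Union[of "{Suc k}" s "{..k}", simplified]
      measure_pmf_single)

lemma S_0: "S 0 = 0"
proof -
  have "0 \<notin> set_pmf s"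
    using support by auto
  then show ?thesis
    using measure_pmf_zero_iff[of s "{..0}"] by (metis Int_insert_right_if0 atMost_0 inf_bot_right)
qed

lemma S_sum: "S k = (\<Sum>j<k. pmf s (Suc j))"
  by (induction k) (simp_all add: S_0 S_Suc del: atMost_0)

lemma S_V: "S V = 1"
proof -
  have "AE k in measure_pmf s. k \<in> {..V}"
    using support by (intro AE_pmfI) auto
  then show ?thesis
    by (subst measure_pmf.prob_eq_1) auto
qed

text \<open>Depth \<open>V\<close> lies beyond every \<open>k < V\<close>; this gives the drift
  argument a lower bound on the probability of a deeper access that is uniform in
  \<open>k\<close>.\<close>

lemma S_gap: "k < V \<Longrightarrow> S k + pmf s V \<le> 1"
proof -
  assume "k < V"
  then have "S k + pmf s V = measure_pmf.prob s ({..k} \<union> {V})"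
    by (subst measure_pmf.finite_measure_Union) (auto simp: measure_pmf_single)
  then show ?thesis by simp
qed

text \<open>Absence of look-ahead for a process with values in any type, phrased by arbitrary
  predicates of the past depths and the present value. In this form it passes to every function of
  these two, in particular to complements of the buffer.\<close>

definition nonanticipating :: "(nat \<Rightarrow> 'w \<Rightarrow> 'b) \<Rightarrow> bool" where
  "nonanticipating G \<longleftrightarrow>
     (\<forall>t D Q. {\<omega> \<in> space M. Q (past t \<omega>) (G t \<omega>)} \<in> events \<and>
        prob {\<omega> \<in> space M. d t \<omega> \<in> D \<and> Q (past t \<omega>) (G t \<omega>)} =
          measure_pmf.prob s D * prob {\<omega> \<in> space M. Q (past t \<omega>) (G t \<omega>)})"

lemma nonanticipating_comp:
  assumes "nonanticipating G"
  shows "nonanticipating (\<lambda>t \<omega>. f t (past t \<omega>) (G t \<omega>))"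
  unfolding nonanticipating_def
proof (intro allI)
  fix t D Q
  show "{\<omega> \<in> space M. Q (past t \<omega>) (f t (past t \<omega>) (G t \<omega>))} \<in> events \<and>
      prob {\<omega> \<in> space M. d t \<omega> \<in> D \<and> Q (past t \<omega>) (f t (past t \<omega>) (G t \<omega>))} =
        measure_pmf.prob s D * prob {\<omega> \<in> space M. Q (past t \<omega>) (f t (past t \<omega>) (G t \<omega>))}"
    using assms[unfolded nonanticipating_def, rule_format, of "\<lambda>p g. Q p (f t p g)" t D] .
qed

lemma nonanticipating_policy:
  assumes "buffer_policy M L0 d A B"
  shows "nonanticipating B"
  unfolding nonanticipating_def
proof (intro allI)
  fix t D Q
  let ?H = "\<lambda>\<omega>. (past t \<omega>, map (\<lambda>u. B u \<omega>) [0..<Suc t])"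
  define E where "E = {\<omega> \<in> space M. Q (past t \<omega>) (B t \<omega>)}"
  define F where "F = {\<omega> \<in> space M. d t \<omega> \<in> D}"
  have indep: "indep_set (sets (vimage_algebra (space M) (d t) (count_space UNIV)))
      (sets (vimage_algebra (space M) ?H (count_space UNIV)))"
    using assms by (auto simp: buffer_policy_def)
  \<comment> \<open>The recorded contents run over the times from 0 to \<open>t\<close>, so the
    entry with index \<open>t\<close> is the present buffer.\<close>
  have *: "F = d t -` D \<inter> space M" "E = ?H -` {(h, b). Q h (b ! t)} \<inter> space M"
    unfolding E_def F_def by (auto simp del: upt_Suc)
  have EF: "F \<in> sets (vimage_algebra (space M) (d t) (count_space UNIV))"
    "E \<in> sets (vimage_algebra (space M) ?H (count_space UNIV))"
    unfolding * by (rule in_vimage_algebra; simp)+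
  have "prob (F \<inter> E) = prob F * prob E"
    using indep EF by (rule indep_setD)
  moreover have "F \<inter> E = {\<omega> \<in> space M. d t \<omega> \<in> D \<and> Q (past t \<omega>) (B t \<omega>)}"
    by (auto simp: E_def F_def)
  moreover have "E \<in> events"
    using indep_setD_ev2[OF indep] EF by blast
  ultimately show "{\<omega> \<in> space M. Q (past t \<omega>) (B t \<omega>)} \<in> events \<and>
        prob {\<omega> \<in> space M. d t \<omega> \<in> D \<and> Q (past t \<omega>) (B t \<omega>)} =
          measure_pmf.prob s D * prob {\<omega> \<in> space M. Q (past t \<omega>) (B t \<omega>)}"
    by (simp add: E_def F_def prob_depth)
qed

text \<open>Here independence of the depths enters: the predicates only concern depths before
  \<open>t\<close>. Together with \<open>nonanticipating_comp\<close> this covers all processes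
  determined by the past depths.\<close>

lemma nonanticipating_const: "nonanticipating (\<lambda>_ _. c)"
  unfolding nonanticipating_def
proof (intro allI)
  fix t D and Q :: "nat list \<Rightarrow> 'b \<Rightarrow> bool"
  show "{\<omega> \<in> space M. Q (past t \<omega>) c} \<in> events \<and>
        prob {\<omega> \<in> space M. d t \<omega> \<in> D \<and> Q (past t \<omega>) c} =
          measure_pmf.prob s D * prob {\<omega> \<in> space M. Q (past t \<omega>) c}"
    unfolding prob_depth[of t, symmetric]
  proof (rule indep_vars_disjoint_functions[where X = d and I = UNIV and J = "{t}" and J' = "{..<t}"
      and h = "\<lambda>x. x t \<in> D" and h' = "\<lambda>x. Q (map x [0..<t]) c"])
    show "Q (map x [0..<t]) c \<longleftrightarrow> Q (map y [0..<t]) c" if "\<And>j. j \<in> {..<t} \<Longrightarrow> x j = y j"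
      for x y :: "nat \<Rightarrow> nat"
    proof -
      have "map x [0..<t] = map y [0..<t]" using that by auto
      then show ?thesis by argo
    qed
  qed (use depths in \<open>auto simp: lru_depths_def\<close>)
qed

lemma stk_past: "lru_stack L0 (nth (past t \<omega>)) t = stk t \<omega>"
  by (rule lru_stack_cong) auto

lemma lifetime_past: "lifetime L0 (nth (past t \<omega>)) t = lifetime L0 (\<lambda>u. d u \<omega>) t"
  by (rule lifetime_cong) auto

lemma
  assumes "nonanticipating G"
  shows events_past: "{\<omega> \<in> space M. Q (past t \<omega>) (G t \<omega>)} \<in> events"
    and events_stack: "{\<omega> \<in> space M. R (stk t \<omega>) (G t \<omega>)} \<in> events"
    and events_depth_stack: "{\<omega> \<in> space M. d t \<omega> \<in> D \<and> R (stk t \<omega>) (G t \<omega>)} \<in> events"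
    and prob_depth_stack: "prob {\<omega> \<in> space M. d t \<omega> \<in> D \<and> R (stk t \<omega>) (G t \<omega>)} =
      measure_pmf.prob s D * prob {\<omega> \<in> space M. R (stk t \<omega>) (G t \<omega>)}"
proof -
  have *: "{\<omega> \<in> space M. Q (past t \<omega>) (G t \<omega>)} \<in> events \<and>
      prob {\<omega> \<in> space M. d t \<omega> \<in> D \<and> Q (past t \<omega>) (G t \<omega>)} =
          measure_pmf.prob s D * prob {\<omega> \<in> space M. Q (past t \<omega>) (G t \<omega>)}" for Q
    using assms unfolding nonanticipating_def by blast
  then show "{\<omega> \<in> space M. Q (past t \<omega>) (G t \<omega>)} \<in> events" by blast
  show ev: "{\<omega> \<in> space M. R (stk t \<omega>) (G t \<omega>)} \<in> events"
    and "prob {\<omega> \<in> space M. d t \<omega> \<in> D \<and> R (stk t \<omega>) (G t \<omega>)} =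
      measure_pmf.prob s D * prob {\<omega> \<in> space M. R (stk t \<omega>) (G t \<omega>)}"
    using *[of "\<lambda>h g. R (lru_stack L0 (nth h) t) g"] unfolding stk_past by auto
  have "{\<omega> \<in> space M. d t \<omega> \<in> D \<and> R (stk t \<omega>) (G t \<omega>)} =
     {\<omega> \<in> space M. d t \<omega> \<in> D} \<inter> {\<omega> \<in> space M. R (stk t \<omega>) (G t \<omega>)}" by auto
  then show "{\<omega> \<in> space M. d t \<omega> \<in> D \<and> R (stk t \<omega>) (G t \<omega>)} \<in> events"
    using ev by simp
qed

text \<open>Positions are counted from 0 here, so that \<open>j\<close> stands for LRU depth \<open>j + 1\<close>.\<close>

definition depth_prob :: "(nat \<Rightarrow> 'w \<Rightarrow> 'a set) \<Rightarrow> nat \<Rightarrow> nat \<Rightarrow> real" where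
  "depth_prob G j t = prob {\<omega> \<in> space M. stk t \<omega> ! j \<in> G t \<omega>}"

lemma depth_prob_bounds: "0 \<le> depth_prob G j t" "depth_prob G j t \<le> 1"
  by (auto simp: depth_prob_def)

text \<open>
  The item at depth \<open>j + 2\<close> was already there if the access went to depth at most \<open>j + 1\<close>, and came
  from depth \<open>j + 1\<close> otherwise; in both cases it was not accessed, so it must have been in \<open>G\<close> before.
\<close>

lemma depth_prob_drift:
  assumes G: "nonanticipating G"
    and step: "AE \<omega> in M. \<forall>t. G (Suc t) \<omega> \<subseteq> insert (acc t \<omega>) (G t \<omega>)"
    and j: "Suc j < V"
  shows "depth_prob G (Suc j) (Suc t) \<le>
    S (Suc j) * depth_prob G (Suc j) t + (1 - S (Suc j)) * depth_prob G j t"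
proof -
  let ?E = "{\<omega> \<in> space M. d t \<omega> \<in> {..Suc j} \<and> stk t \<omega> ! Suc j \<in> G t \<omega>}"
  let ?F = "{\<omega> \<in> space M. d t \<omega> \<in> - {..Suc j} \<and> stk t \<omega> ! j \<in> G t \<omega>}"
  have "?E \<in> events" "?F \<in> events"
    using events_depth_stack[OF G, where R = "\<lambda>l g. l ! Suc j \<in> g"]
      events_depth_stack[OF G, where R = "\<lambda>l g. l ! j \<in> g"] by blast+
  have "AE \<omega> in M. \<omega> \<in> {\<omega> \<in> space M. stk (Suc t) \<omega> ! Suc j \<in> G (Suc t) \<omega>} \<longrightarrow> \<omega> \<in> ?E \<union> ?F"
    using AE_depths step
  proof eventually_elim
    case (elim \<omega>)
    have len: "length (stk t \<omega>) = V" "length (stk (Suc t) \<omega>) = V"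
      using elim(1) by (auto intro!: length_lru_stack simp del: lru_stack.simps)
    have "distinct (stk (Suc t) \<omega>)"
      using elim(1) distinct_L0 by (subst distinct_lru_stack) auto
    then have "stk (Suc t) \<omega> ! Suc j \<noteq> stk (Suc t) \<omega> ! 0"
      using len j nth_eq_iff_index_eq by fastforce
    moreover have "stk (Suc t) \<omega> ! 0 = acc t \<omega>"
      by (simp add: next_access_def)
    moreover have "stk (Suc t) \<omega> ! Suc j = (if Suc j < d t \<omega> then stk t \<omega> ! j else stk t \<omega> ! Suc j)"
      using elim(1) len j by (simp add: move_to_top_nth_Suc)
    ultimately have "stk (Suc t) \<omega> ! Suc j \<noteq> acc t \<omega>"
      "stk (Suc t) \<omega> ! Suc j = (if Suc j < d t \<omega> then stk t \<omega> ! j else stk t \<omega> ! Suc j)"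
      by argo+
    moreover have "G (Suc t) \<omega> \<subseteq> insert (acc t \<omega>) (G t \<omega>)"
      using elim(2) by blast
    ultimately show ?case
      by (cases "Suc j < d t \<omega>") (auto simp del: lru_stack.simps)
  qed
  then have "depth_prob G (Suc j) (Suc t) \<le> prob (?E \<union> ?F)"
    unfolding depth_prob_def by (rule finite_measure_mono_AE) (rule sets.Un; fact)
  also have "\<dots> \<le> prob ?E + prob ?F"
    by (rule measure_Un_le) fact+
  also have "prob ?E = S (Suc j) * depth_prob G (Suc j) t"
    unfolding depth_prob_def by (rule prob_depth_stack[OF G, where R = "\<lambda>l g. l ! Suc j \<in> g"])
  also have "prob ?F = measure_pmf.prob s (- {..Suc j}) * depth_prob G j t"
    unfolding depth_prob_def by (rule prob_depth_stack[OF G, where R = "\<lambda>l g. l ! j \<in> g"])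
  also have "measure_pmf.prob s (- {..Suc j}) = 1 - S (Suc j)"
    using measure_pmf.prob_compl[of "{..Suc j}" s] by (simp add: Compl_eq_Diff_UNIV)
  finally show ?thesis .
qed

definition total :: "(nat \<Rightarrow> 'w \<Rightarrow> 'a set) \<Rightarrow> nat \<Rightarrow> nat \<Rightarrow> real" where
  "total G j T = (\<Sum>t<T. depth_prob G j t)"

text \<open>By the drift inequality, \<open>1 - S (Suc j)\<close> times the excess of position
  \<open>Suc j\<close> over position \<open>j\<close> is at most a difference of consecutive values
  in time; the sum over time telescopes to at most 1.\<close>

lemma total_Suc_le:
  assumes G: "nonanticipating G"
    and step: "AE \<omega> in M. \<forall>t. G (Suc t) \<omega> \<subseteq> insert (acc t \<omega>) (G t \<omega>)"
    and j: "Suc j < V"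
  shows "total G (Suc j) T \<le> total G j T + 1 / pmf s V"
proof (cases "total G (Suc j) T \<le> total G j T")
  case True
  then show ?thesis by (simp add: add_increasing2)
next
  case False
  let ?x = "depth_prob G"
  have "(1 - S (Suc j)) * (total G (Suc j) T - total G j T) =
      (\<Sum>t<T. (1 - S (Suc j)) * (?x (Suc j) t - ?x j t))"
    by (simp add: total_def sum_distrib_left sum_subtractf right_diff_distrib)
  also have "\<dots> \<le> (\<Sum>t<T. ?x (Suc j) t - ?x (Suc j) (Suc t))"
    using depth_prob_drift[OF assms] by (intro sum_mono) (simp add: algebra_simps)
  also have "\<dots> = ?x (Suc j) 0 - ?x (Suc j) T"
    by (rule sum_lessThan_telescope')
  also have "\<dots> \<le> 1"
    using depth_prob_bounds[of G "Suc j" 0] depth_prob_bounds[of G "Suc j" T] by linarith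
  finally have "(1 - S (Suc j)) * (total G (Suc j) T - total G j T) \<le> 1" .
  \<comment> \<open>The smaller factor may replace \<open>1 - S (Suc j)\<close> because the excess
    is positive in this case.\<close>
  moreover have "pmf s V * (total G (Suc j) T - total G j T) \<le>
      (1 - S (Suc j)) * (total G (Suc j) T - total G j T)"
    using S_gap[OF j] False by (intro mult_right_mono) auto
  ultimately have "total G (Suc j) T - total G j T \<le> 1 / pmf s V"
    using pmf_last_pos by (simp add: field_simps)
  then show ?thesis by simp
qed

text \<open>Almost surely the stack lists every item exactly once, so the buffered items are counted
  by the stack positions that hold them.\<close>

lemma integral_card:
  assumes B: "nonanticipating B" and sub: "AE \<omega> in M. B t \<omega> \<subseteq> set L0"
  shows "(\<integral>\<omega>. real (card (B t \<omega>)) \<partial>M) = (\<Sum>j<V. depth_prob B j t)"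
proof -
  let ?E = "\<lambda>j. {\<omega> \<in> space M. stk t \<omega> ! j \<in> B t \<omega>}"
  have E: "?E j \<in> events" for j
    using events_stack[OF B, where R = "\<lambda>l g. l ! j \<in> g"] by auto
  have "(\<integral>\<omega>. real (card (B t \<omega>)) \<partial>M) = (\<integral>\<omega>. (\<Sum>j<V. indicator (?E j) \<omega>) \<partial>M)"
  proof (rule integral_cong_AE)
    have "(\<lambda>\<omega>. B t \<omega>) \<in> M \<rightarrow>\<^sub>M count_space UNIV"
      using events_stack[OF B, where R = "\<lambda>_ g. g \<in> X" for X]
      by (intro measurableI) (auto simp: vimage_def Int_def conj_commute)
    then show "(\<lambda>\<omega>. real (card (B t \<omega>))) \<in> borel_measurable M"
      by (rule measurable_compose) auto
    show "(\<lambda>\<omega>. \<Sum>j<V. indicator (?E j) \<omega> :: real) \<in> borel_measurable M"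
      using E by auto
    show "AE \<omega> in M. real (card (B t \<omega>)) = (\<Sum>j<V. indicator (?E j) \<omega>)"
      using AE_depths sub AE_space
    proof eventually_elim
      case (elim \<omega>)
      have len: "length (stk t \<omega>) = V" "set (stk t \<omega>) = set L0" "distinct (stk t \<omega>)"
        using elim(1) distinct_L0 by (auto simp: length_lru_stack set_lru_stack distinct_lru_stack)
      have "B t \<omega> \<subseteq> (\<lambda>j. stk t \<omega> ! j) ` {j\<in>{..<V}. stk t \<omega> ! j \<in> B t \<omega>}"
      proof
        fix y assume y: "y \<in> B t \<omega>"
        then obtain j where "j < V" "stk t \<omega> ! j = y"
          using elim(2) len in_set_conv_nth[of y "stk t \<omega>"] by auto
        then show "y \<in> (\<lambda>j. stk t \<omega> ! j) ` {j\<in>{..<V}. stk t \<omega> ! j \<in> B t \<omega>}"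
          using y by auto
      qed
      then have "bij_betw (\<lambda>j. stk t \<omega> ! j) {j\<in>{..<V}. stk t \<omega> ! j \<in> B t \<omega>} (B t \<omega>)"
        using len by (auto simp: bij_betw_def inj_on_def nth_eq_iff_index_eq)
      then have "card (B t \<omega>) = card {j\<in>{..<V}. stk t \<omega> ! j \<in> B t \<omega>}"
        by (rule bij_betw_same_card[symmetric])
      also have "real \<dots> = (\<Sum>j | j \<in> {..<V} \<and> stk t \<omega> ! j \<in> B t \<omega>. 1)"
        by simp
      also have "\<dots> = (\<Sum>j<V. if stk t \<omega> ! j \<in> B t \<omega> then 1 else 0)"
        by (rule sum.inter_filter) auto
      also have "\<dots> = (\<Sum>j<V. indicator (?E j) \<omega>)"
        using elim(3) by (intro sum.cong) auto
      finally show ?case .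
    qed
  qed
  also have "\<dots> = (\<Sum>j<V. depth_prob B j t)"
    using E by (subst Bochner_Integration.integral_sum)
      (auto simp: depth_prob_def less_top[symmetric] intro!: integrable_real_indicator)
  finally show ?thesis .
qed

text \<open>The event is split by the accessed position: depth \<open>Suc j\<close> points to
  position \<open>j\<close>, and \<open>d t\<close> is independent of the stack and of
  \<open>G t\<close>.\<close>

lemma prob_acc:
  assumes G: "nonanticipating G"
  shows "prob {\<omega> \<in> space M. acc t \<omega> \<in> G t \<omega>} = (\<Sum>j<V. pmf s (Suc j) * depth_prob G j t)"
proof -
  let ?E = "\<lambda>j. {\<omega> \<in> space M. d t \<omega> \<in> {Suc j} \<and> stk t \<omega> ! j \<in> G t \<omega>}"
  let ?F = "{\<omega> \<in> space M. acc t \<omega> \<in> G t \<omega>}"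
  have E: "?E j \<in> events" for j
    using events_depth_stack[OF G, where R = "\<lambda>l g. l ! j \<in> g"] by blast
  \<comment> \<open>This equality has to hold for every outcome and not just almost surely, so the
    union runs over all \<open>k\<close>, including values outside the support.\<close>
  have "?F = (\<Union>k. {\<omega> \<in> space M. d t \<omega> \<in> {k} \<and> stk t \<omega> ! (k - 1) \<in> G t \<omega>})"
    by (auto simp: next_access_def)
  also have "\<dots> \<in> events"
    using events_depth_stack[OF G, where R = "\<lambda>l g. l ! (k - 1) \<in> g" for k]
    by (intro sets.countable_UN) blast
  finally have "?F \<in> events" .
  then have "prob ?F = (\<Sum>j<V. prob (?E j))"
  proof (intro prob_sum)
    show "AE \<omega> in M. (\<forall>j\<in>{..<V}. d t \<omega> \<in> {Suc j} \<and> stk t \<omega> ! j \<in> G t \<omega> \<longrightarrow> acc t \<omega> \<in> G t \<omega>) \<and>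
       (acc t \<omega> \<in> G t \<omega> \<longrightarrow> (\<exists>!j. j \<in> {..<V} \<and> d t \<omega> \<in> {Suc j} \<and> stk t \<omega> ! j \<in> G t \<omega>))"
      using AE_depths
    proof eventually_elim
      case (elim \<omega>)
      have "Suc (d t \<omega> - 1) = d t \<omega>" "d t \<omega> - 1 < V"
        using elim[rule_format, of t] by auto
      then show ?case
        by (auto simp: next_access_def intro!: ex1I[of _ "d t \<omega> - 1"])
    qed
  qed (use E in auto)
  also have "\<dots> = (\<Sum>j<V. pmf s (Suc j) * depth_prob G j t)"
    using prob_depth_stack[OF G, where R = "\<lambda>l g. l ! j \<in> g" and D = "{Suc j}" for j]
    by (simp add: depth_prob_def measure_pmf_single)
  finally show ?thesis .
qed

lemma depth_prob_diff:
  assumes G: "nonanticipating G" and sub: "AE \<omega> in M. G t \<omega> \<subseteq> A"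
  shows "depth_prob (\<lambda>t \<omega>. A - G t \<omega>) j t = depth_prob (\<lambda>_ _. A) j t - depth_prob G j t"
proof -
  have "prob {\<omega> \<in> space M. stk t \<omega> ! j \<in> A} =
    prob ({\<omega> \<in> space M. stk t \<omega> ! j \<in> A - G t \<omega>} \<union> {\<omega> \<in> space M. stk t \<omega> ! j \<in> G t \<omega>})"
    using sub events_stack[OF G, where R = "\<lambda>l g. l ! j \<in> A - g"]
      events_stack[OF G, where R = "\<lambda>l g. l ! j \<in> g"]
      events_stack[OF G, where R = "\<lambda>l g. l ! j \<in> A"]
    by (intro finite_measure_eq_AE) auto
  also have "\<dots> = prob {\<omega> \<in> space M. stk t \<omega> ! j \<in> A - G t \<omega>} + prob {\<omega> \<in> space M. stk t \<omega> ! j \<in> G t \<omega>}"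
    using events_stack[OF G, where R = "\<lambda>l g. l ! j \<in> A - g"]
      events_stack[OF G, where R = "\<lambda>l g. l ! j \<in> g"]
    by (intro finite_measure_Union) auto
  finally show ?thesis
    by (simp add: depth_prob_def)
qed

subsection \<open>Long-run averages\<close>

text \<open>The Lagrangian bound on the hits. Prefix sums of \<open>pmf s (Suc j) - \<mu>\<close>
  are \<open>S k - \<mu> * real k\<close>, and \<open>R\<close> does not depend on \<open>T\<close>,
  so it disappears from time averages.\<close>

lemma weighted_total_le:
  assumes G: "nonanticipating G"
    and step: "AE \<omega> in M. \<forall>t. G (Suc t) \<omega> \<subseteq> insert (acc t \<omega>) (G t \<omega>)"
    and F: "\<And>k. k \<in> {1..V} \<Longrightarrow> S k - \<mu> * real k \<le> F"
  shows "\<exists>R. \<forall>T. (\<Sum>j<V. (pmf s (Suc j) - \<mu>) * total G j T) \<le> F * total G 0 T + R"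
proof (intro exI allI)
  fix T
  define c where "c = 1 / pmf s V"
  have c: "0 \<le> c" by (simp add: c_def)
  let ?f = "\<lambda>j. pmf s (Suc j) - \<mu>"
  \<comment> \<open>The totals are nonincreasing in \<open>j\<close> only up to an error of
    \<open>c\<close> per position; the linear term makes the sequence exactly nonincreasing.\<close>
  let ?y = "\<lambda>j. total G j T + c * real (V - j)"
  have "(\<Sum>j<V. ?f j * ?y j) \<le> F * ?y 0"
  proof (rule abel_summation_le[OF _ _ _ V_pos])
    show "?y (Suc j) \<le> ?y j" if "Suc j < V" for j
    proof -
      have "real (V - j) = real (V - Suc j) + 1"
        using that by linarith
      then have "c * real (V - j) = c * real (V - Suc j) + c"
        by (simp only: distrib_left mult_1_right)
      then show ?thesis
        using total_Suc_le[OF G step that, of T] unfolding c_def[symmetric] by linarith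
    qed
    show "0 \<le> ?y j" for j
      using c depth_prob_bounds by (auto simp: total_def intro!: add_nonneg_nonneg sum_nonneg)
    show "(\<Sum>j<k. ?f j) \<le> F" if "k \<in> {1..V}" for k
      using F[OF that] by (simp add: sum_subtractf S_sum mult.commute)
  qed
  then show "(\<Sum>j<V. ?f j * total G j T) \<le> F * total G 0 T +
      (F * (c * real V) - (\<Sum>j<V. ?f j * (c * real (V - j))))"
    by (simp add: distrib_left sum.distrib)
qed

lemma depth_prob_all: 
  assumes "j < V"
  shows "depth_prob (\<lambda>_ _. set L0) j t = 1"
proof -
  have "AE \<omega> in M. stk t \<omega> ! j \<in> set L0"
    using AE_depths
  proof eventually_elim
    case (elim \<omega>)
    then show ?case
      using assms length_lru_stack[of "\<lambda>u. d u \<omega>" L0 t] set_lru_stack[of "\<lambda>u. d u \<omega>" L0 t] nth_mem by metis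
  qed
  moreover have "{\<omega> \<in> space M. stk t \<omega> ! j \<in> set L0} \<in> events"
    using events_stack[OF nonanticipating_const, where R = "\<lambda>l _. l ! j \<in> set L0"] .
  ultimately show ?thesis
    unfolding depth_prob_def by (subst prob_Collect_eq_1)
qed

text \<open>The reverse inequality is obtained by applying the drift inequality to the complement of \<open>A\<close>.\<close>

lemma total_const_diff:
  assumes A: "A \<subseteq> set L0" and j: "Suc j < V"
  shows "\<bar>total (\<lambda>_ _. A) (Suc j) T - total (\<lambda>_ _. A) j T\<bar> \<le> 1 / pmf s V"
proof -
  have "total (\<lambda>_ _. set L0 - A) i T = real T - total (\<lambda>_ _. A) i T" if "i < V" for i
    using that A depth_prob_diff[where G = "\<lambda>_ _. A" and A = "set L0" and j = i, OF nonanticipating_const]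
    by (simp add: total_def depth_prob_all sum_subtractf)
  moreover have "total (\<lambda>_ _. set L0 - A) (Suc j) T \<le> total (\<lambda>_ _. set L0 - A) j T + 1 / pmf s V"
    "total (\<lambda>_ _. A) (Suc j) T \<le> total (\<lambda>_ _. A) j T + 1 / pmf s V"
    using j by (auto intro!: total_Suc_le nonanticipating_const)
  ultimately show ?thesis
    using j by auto
qed

text \<open>All positions have the same limiting average, as their totals differ by bounded amounts,
  and at each time the expected number of positions occupied by \<open>A\<close> is
  \<open>card A\<close>.\<close>

lemma avg_total_const:
  assumes A: "A \<subseteq> set L0" and j: "j < V"
  shows "(\<lambda>T. total (\<lambda>_ _. A) j T / real T) \<longlonglongrightarrow> real (card A) / real V"
proof -
  let ?w = "\<lambda>j T. total (\<lambda>_ _. A) j T"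
  have diff: "(\<lambda>T. (?w j T - ?w 0 T) / real T) \<longlonglongrightarrow> 0" if "j < V" for j
    using that
  proof (induction j)
    case (Suc j)
    have "(\<lambda>T. (?w (Suc j) T - ?w j T) / real T) \<longlonglongrightarrow> 0"
      using total_const_diff[OF A Suc.prems] by (rule tendsto_div_bounded)
    then have "(\<lambda>T. (?w (Suc j) T - ?w j T) / real T + (?w j T - ?w 0 T) / real T) \<longlonglongrightarrow> 0 + 0"
      using Suc by (intro tendsto_add) auto
    then show ?case
      by (simp add: diff_divide_distrib)
  qed simp
  have card: "(\<Sum>j<V. depth_prob (\<lambda>_ _. A) j t) = card A" for t
    using integral_card[OF nonanticipating_const, of A] A by (simp add: prob_space)
  have "(\<Sum>j<V. ?w j T) = real (card A) * real T" for T
    unfolding total_def by (subst sum.swap) (simp add: card)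
  then have "(\<lambda>T. (\<Sum>j<V. ?w j T) / real T) \<longlonglongrightarrow> real (card A)"
    by (intro tendsto_eventually eventually_sequentiallyI[of 1]) simp
  \<comment> \<open>Subtracting the differences to position 0 from the sum over all positions leaves
    \<open>real V\<close> copies of the average at position 0.\<close>
  then have "(\<lambda>T. ((\<Sum>j<V. ?w j T) / real T - (\<Sum>j<V. (?w j T - ?w 0 T) / real T)) / real V)
      \<longlonglongrightarrow> (real (card A) - (\<Sum>j<V. 0)) / real V"
    using V_pos by (intro tendsto_divide tendsto_diff tendsto_sum diff tendsto_const) auto
  also have "(\<lambda>T. ((\<Sum>j<V. ?w j T) / real T - (\<Sum>j<V. (?w j T - ?w 0 T) / real T)) / real V) =
      (\<lambda>T. ?w 0 T / real T)"
    using V_pos by (simp add: sum_divide_distrib diff_divide_distrib sum_subtractf fun_eq_iff)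
  finally have "(\<lambda>T. ?w 0 T / real T + (?w j T - ?w 0 T) / real T) \<longlonglongrightarrow> real (card A) / real V + 0"
    by (intro tendsto_add diff j) simp
  then show ?thesis
    by (simp add: diff_divide_distrib)
qed

text \<open>These items are in no threshold buffer yet, since it starts empty; they are the error
  term in its depth frequencies.\<close>

definition unaccessed :: "'a set \<Rightarrow> nat \<Rightarrow> 'w \<Rightarrow> 'a set" where
  "unaccessed A t \<omega> = {y \<in> A. lifetime L0 (\<lambda>u. d u \<omega>) t y = 0}"

lemma nonanticipating_unaccessed: "nonanticipating (unaccessed A)"
  using nonanticipating_comp[OF nonanticipating_const, of "\<lambda>t p (_ :: unit). {y \<in> A. lifetime L0 (nth p) t y = 0}"]
  unfolding lifetime_past unaccessed_def[abs_def] .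

text \<open>From time 1 on, the top of the stack has just been accessed, so position 0 contributes
  at most 1 to the total; the drift inequality carries a bounded total from each position to the
  next.\<close>

lemma avg_total_unaccessed:
  assumes "j < V"
  shows "(\<lambda>T. total (unaccessed A) j T / real T) \<longlonglongrightarrow> 0"
proof -
  let ?x = "depth_prob (unaccessed A)"
  have "?x 0 (Suc t) = 0" for t
    unfolding depth_prob_def unaccessed_def
    by (simp add: lifetime_Suc next_access_def)
  then have "?x 0 t \<le> (if t = 0 then 1 else 0)" for t
    using depth_prob_bounds(2)[of "unaccessed A" 0 t] by (cases t) auto
  then have "total (unaccessed A) 0 T \<le> (\<Sum>t<T. if t = 0 then 1 else 0)" for T
    unfolding total_def by (rule sum_mono)
  also have "(\<Sum>t<T. if t = 0 then 1 else 0) \<le> (1::real)" for T :: nat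
    by (simp add: sum.delta)
  finally have "total (unaccessed A) 0 T \<le> 1" for T .
  then have "total (unaccessed A) j T \<le> 1 + real j / pmf s V" for T
    using assms
  proof (induction j)
    case (Suc j)
    have "total (unaccessed A) (Suc j) T \<le> total (unaccessed A) j T + 1 / pmf s V"
      using Suc.prems by (intro total_Suc_le nonanticipating_unaccessed) (auto simp: unaccessed_def lifetime_Suc)
    then show ?case
      using Suc by (simp add: add_divide_distrib)
  qed simp
  moreover have "0 \<le> total (unaccessed A) j T" for T
    using depth_prob_bounds unfolding total_def by (intro sum_nonneg) auto
  ultimately show ?thesis
    by (intro tendsto_div_bounded) (auto simp: abs_le_iff intro: order_trans[of _ 0])
qed

section \<open>Long-run costs of an arbitrary policy\<close>

context
  fixes A :: "'a set" and B :: "nat \<Rightarrow> 'w \<Rightarrow> 'a set"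
  assumes A: "A \<subseteq> set L0" and B: "buffer_policy M L0 d A B"
begin

lemma policy_paths:
  "AE \<omega> in M. B 0 \<omega> \<subseteq> A \<and> (\<forall>t. {acc t \<omega>} \<inter> A \<subseteq> B (Suc t) \<omega> \<and>
     B (Suc t) \<omega> \<subseteq> B t \<omega> \<union> ({acc t \<omega>} \<inter> A))"
  using B by (simp add: buffer_policy_def)

lemma policy_subset: "AE \<omega> in M. \<forall>t. B t \<omega> \<subseteq> A"
  using policy_paths
proof eventually_elim
  case (elim \<omega>)
  have "B t \<omega> \<subseteq> A" for t
    using elim by (induction t) blast+
  then show ?case by blast
qed

lemma policy_step: "AE \<omega> in M. \<forall>t. B (Suc t) \<omega> \<subseteq> insert (acc t \<omega>) (B t \<omega>)"
  using policy_paths by eventually_elim blast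

lemma policy_nonanticipating: "nonanticipating B"
  using B by (rule nonanticipating_policy)

lemma avg_occupancy_eq: "avg_occupancy M B T = (\<Sum>j<V. total B j T) / real T"
proof -
  have "(\<integral>\<omega>. real (card (B t \<omega>)) \<partial>M) = (\<Sum>j<V. depth_prob B j t)" for t
    using policy_subset A by (intro integral_card policy_nonanticipating) auto
  then show ?thesis
    by (simp add: avg_occupancy_def total_def sum.swap[of _ "{..<T}"])
qed

lemma avg_misses_eq:
  "avg_misses M L0 d A B T = (\<Sum>j<V. pmf s (Suc j) * (total (\<lambda>_ _. A) j T - total B j T)) / real T"
proof -
  have "prob {\<omega> \<in> space M. acc t \<omega> \<in> A - B t \<omega>} =
      (\<Sum>j<V. pmf s (Suc j) * (depth_prob (\<lambda>_ _. A) j t - depth_prob B j t))" for t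
  proof -
    have "nonanticipating (\<lambda>t \<omega>. A - B t \<omega>)"
      using nonanticipating_comp[OF policy_nonanticipating, of "\<lambda>_ _ b. A - b"] .
    moreover have "AE \<omega> in M. B t \<omega> \<subseteq> A"
      using policy_subset by eventually_elim blast
    ultimately show ?thesis
      using prob_acc[of "\<lambda>t \<omega>. A - B t \<omega>" t]
      by (simp add: depth_prob_diff[OF policy_nonanticipating] del: Diff_iff)
  qed
  then have "avg_misses M L0 d A B T =
      (\<Sum>t<T. \<Sum>j<V. pmf s (Suc j) * (depth_prob (\<lambda>_ _. A) j t - depth_prob B j t)) / real T"
    by (simp add: avg_misses_def del: Diff_iff)
  also have "(\<Sum>t<T. \<Sum>j<V. pmf s (Suc j) * (depth_prob (\<lambda>_ _. A) j t - depth_prob B j t)) =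
      (\<Sum>j<V. pmf s (Suc j) * (total (\<lambda>_ _. A) j T - total B j T))"
    by (subst sum.swap) (simp add: total_def sum_subtractf sum_distrib_left right_diff_distrib)
  finally show ?thesis .
qed

text \<open>From time 1 on, the top of the stack is the item just accessed, which is buffered
  exactly when it belongs to \<open>A\<close>; only time 0 can differ, by at most 1.\<close>

lemma avg_total_policy_top:
  "(\<lambda>T. total B 0 T / real T) \<longlonglongrightarrow> real (card A) / real V"
proof -
  have "AE \<omega> in M. stk (Suc t) \<omega> ! 0 \<in> B (Suc t) \<omega> \<longleftrightarrow> stk (Suc t) \<omega> ! 0 \<in> A" for t
    using policy_paths policy_subset by eventually_elim (auto simp: next_access_def)
  then have "depth_prob B 0 (Suc t) = depth_prob (\<lambda>_ _. A) 0 (Suc t)" for t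
    unfolding depth_prob_def
    using events_stack[OF policy_nonanticipating, where R = "\<lambda>l b. l ! 0 \<in> b"]
      events_stack[OF policy_nonanticipating, where R = "\<lambda>l b. l ! 0 \<in> A"]
    by (intro finite_measure_eq_AE) (auto simp del: lru_stack.simps)
  then have "\<bar>depth_prob B 0 t - depth_prob (\<lambda>_ _. A) 0 t\<bar> \<le> (if t = 0 then 1 else 0)" for t
    using depth_prob_bounds[of B 0 t] depth_prob_bounds[of "\<lambda>_ _. A" 0 t] by (cases t) auto
  then have "(\<Sum>t<T. \<bar>depth_prob B 0 t - depth_prob (\<lambda>_ _. A) 0 t\<bar>) \<le> (\<Sum>t<T. if t = 0 then 1 else 0)" for T
    by (rule sum_mono)
  also have "(\<Sum>t<T. if t = 0 then 1 else 0) \<le> (1::real)" for T :: nat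
    by (simp add: sum.delta)
  finally have "(\<Sum>t<T. \<bar>depth_prob B 0 t - depth_prob (\<lambda>_ _. A) 0 t\<bar>) \<le> 1" for T .
  then have "\<bar>total B 0 T - total (\<lambda>_ _. A) 0 T\<bar> \<le> 1" for T
    unfolding total_def sum_subtractf[symmetric] by (rule order_trans[OF sum_abs])
  then have "(\<lambda>T. (total B 0 T - total (\<lambda>_ _. A) 0 T) / real T) \<longlonglongrightarrow> 0"
    by (rule tendsto_div_bounded)
  from tendsto_add[OF this avg_total_const[OF A V_pos]] show ?thesis
    by (simp add: diff_divide_distrib)
qed

text \<open>The miss averages of an arbitrary policy may fail to converge, so the bound is stated
  through a convergent minorant \<open>g\<close>, which serves both limits and
  \<open>liminf\<close>. Its limit is the access rate \<open>card A / V\<close> less the bound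
  \<open>\<mu> * b + F * card A / V\<close> on the hit rate.\<close>

lemma policy_lower_bound:
  assumes occ: "avg_occupancy M B \<longlonglongrightarrow> b"
    and F: "\<And>k. k \<in> {1..V} \<Longrightarrow> S k - \<mu> * real k \<le> F"
  obtains g where "\<And>T. 0 < T \<Longrightarrow> g T \<le> avg_misses M L0 d A B T"
    and "g \<longlonglongrightarrow> real (card A) / real V * (1 - F) - \<mu> * b"
proof -
  obtain R where R: "\<And>T. (\<Sum>j<V. (pmf s (Suc j) - \<mu>) * total B j T) \<le> F * total B 0 T + R"
    using weighted_total_le[OF policy_nonanticipating policy_step F] by blast
  let ?w = "total (\<lambda>_ _. A)"
  define g where "g T = (\<Sum>j<V. pmf s (Suc j) * (?w j T / real T)) - \<mu> * avg_occupancy M B T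
    - F * (total B 0 T / real T) - R / real T" for T
  show ?thesis
  proof
    show "g T \<le> avg_misses M L0 d A B T" if "0 < T" for T
    proof -
      have "(\<Sum>j<V. pmf s (Suc j) * (?w j T / real T)) = (\<Sum>j<V. pmf s (Suc j) * ?w j T) / real T"
        by (simp add: sum_divide_distrib)
      then have "g T = ((\<Sum>j<V. pmf s (Suc j) * ?w j T) - \<mu> * (\<Sum>j<V. total B j T) - F * total B 0 T - R) / real T"
        by (simp add: g_def avg_occupancy_eq diff_divide_distrib)
      also have "\<dots> \<le> (\<Sum>j<V. pmf s (Suc j) * (?w j T - total B j T)) / real T"
        using R[of T]
        by (intro divide_right_mono)
          (auto simp: left_diff_distrib right_diff_distrib sum_subtractf sum_distrib_left)
      finally show ?thesis
        by (simp add: avg_misses_eq)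
    qed
    have "g \<longlonglongrightarrow> (\<Sum>j<V. pmf s (Suc j) * (real (card A) / real V)) - \<mu> * b
        - F * (real (card A) / real V) - 0"
      unfolding g_def[abs_def]
      by (intro tendsto_diff tendsto_sum tendsto_mult tendsto_const occ avg_total_const A
          avg_total_policy_top lim_const_over_n) auto
    also have "(\<Sum>j<V. pmf s (Suc j) * (real (card A) / real V)) = real (card A) / real V"
      using S_V by (simp add: S_sum sum_distrib_right[symmetric] del: times_divide_eq_right)
    finally show "g \<longlonglongrightarrow> real (card A) / real V * (1 - F) - \<mu> * b"
      by (simp add: algebra_simps diff_divide_distrib)
  qed
qed

lemma has_costs_if_avg_total:
  assumes "\<And>j. j < V \<Longrightarrow> (\<lambda>T. total B j T / real T) \<longlonglongrightarrow> x j"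
  shows "has_costs M L0 d A B (\<Sum>j<V. x j, \<Sum>j<V. pmf s (Suc j) * (real (card A) / real V - x j))"
proof -
  have "avg_occupancy M B = (\<lambda>T. \<Sum>j<V. total B j T / real T)"
    by (simp add: avg_occupancy_eq fun_eq_iff sum_divide_distrib)
  moreover have "(\<lambda>T. \<Sum>j<V. total B j T / real T) \<longlonglongrightarrow> (\<Sum>j<V. x j)"
    by (intro tendsto_sum assms) auto
  moreover have "avg_misses M L0 d A B =
      (\<lambda>T. \<Sum>j<V. pmf s (Suc j) * (total (\<lambda>_ _. A) j T / real T - total B j T / real T))"
    by (simp add: avg_misses_eq fun_eq_iff sum_divide_distrib diff_divide_distrib right_diff_distrib)
  moreover have "(\<lambda>T. \<Sum>j<V. pmf s (Suc j) * (total (\<lambda>_ _. A) j T / real T - total B j T / real T)) \<longlonglongrightarrow>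
      (\<Sum>j<V. pmf s (Suc j) * (real (card A) / real V - x j))"
    by (intro tendsto_sum tendsto_mult tendsto_diff tendsto_const assms avg_total_const A) auto
  ultimately show ?thesis
    by (simp add: has_costs_def)
qed

end


subsection \<open>Threshold policies\<close>

abbreviation ev :: "'a set \<Rightarrow> ('a \<Rightarrow> nat \<Rightarrow> 'w \<Rightarrow> nat) \<Rightarrow> nat \<Rightarrow> 'w \<Rightarrow> 'a set" where
  "ev A K t \<omega> \<equiv> ev_buffer A (\<lambda>y n. K y n \<omega>) L0 (\<lambda>u. d u \<omega>) t"

text \<open>The preimage algebras over \<open>count_space UNIV\<close> consist of all preimages, so
  the product rule for arbitrary \<open>D\<close> and \<open>Q\<close> amounts to independence. A
  positive threshold keeps an item that has just reached the top.\<close>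

lemma ev_policyI:
  assumes pos: "AE \<omega> in M. \<forall>y\<in>A. \<forall>n. 0 < K y n \<omega>"
    and indep: "\<And>t D Q. {\<omega> \<in> space M. Q (past t \<omega>) (map (\<lambda>u. ev A K u \<omega>) [0..<Suc t])} \<in> events \<and>
      prob {\<omega> \<in> space M. d t \<omega> \<in> D \<and> Q (past t \<omega>) (map (\<lambda>u. ev A K u \<omega>) [0..<Suc t])} =
      prob {\<omega> \<in> space M. d t \<omega> \<in> D} *
      prob {\<omega> \<in> space M. Q (past t \<omega>) (map (\<lambda>u. ev A K u \<omega>) [0..<Suc t])}"
  shows "buffer_policy M L0 d A (ev A K)"
  unfolding buffer_policy_def
proof (intro conjI allI)
  show "AE \<omega> in M. ev A K 0 \<omega> \<subseteq> A \<and> (\<forall>t. {acc t \<omega>} \<inter> A \<subseteq> ev A K (Suc t) \<omega> \<and>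
      ev A K (Suc t) \<omega> \<subseteq> ev A K t \<omega> \<union> ({acc t \<omega>} \<inter> A))"
    using pos
  proof eventually_elim
    case (elim \<omega>)
    have "acc t \<omega> \<in> set (take k (stk (Suc t) \<omega>))" if "0 < k" for k t
      using that by (cases k) (auto simp: move_to_top_def next_access_def)
    then show ?case
      using elim by (auto simp del: lru_stack.simps)
  qed
  fix t
  let ?H = "\<lambda>\<omega>. (past t \<omega>, map (\<lambda>u. ev A K u \<omega>) [0..<Suc t])"
  have pre: "?H -` X \<inter> space M = {\<omega> \<in> space M. (\<lambda>p b. (p, b) \<in> X) (past t \<omega>) (map (\<lambda>u. ev A K u \<omega>) [0..<Suc t])}"
    "d t -` D \<inter> space M = {\<omega> \<in> space M. d t \<omega> \<in> D}"
    "(d t -` D \<inter> space M) \<inter> (?H -` X \<inter> space M) =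
      {\<omega> \<in> space M. d t \<omega> \<in> D \<and> (\<lambda>p b. (p, b) \<in> X) (past t \<omega>) (map (\<lambda>u. ev A K u \<omega>) [0..<Suc t])}" for X D
    by (auto simp del: upt_Suc)
  have "prob ((d t -` D \<inter> space M) \<inter> (?H -` X \<inter> space M)) =
      prob (d t -` D \<inter> space M) * prob (?H -` X \<inter> space M)" for X D
    by (subst pre(3), subst pre(1), subst pre(2)) (rule indep[THEN conjunct2])
  moreover have "?H -` X \<inter> space M \<in> events" for X
    by (subst pre(1)) (rule indep[THEN conjunct1])
  moreover have "d t -` D \<inter> space M \<in> events" for D
    using measurable_depth by (rule measurable_sets) simp
  ultimately show "indep_set (sets (vimage_algebra (space M) (d t) (count_space UNIV)))
      (sets (vimage_algebra (space M) ?H (count_space UNIV)))"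
    unfolding indep_sets2_eq by (auto simp: sets_vimage_algebra2 simp del: upt_Suc)
qed

lemma ev_const_policy:
  assumes "0 < k"
  shows "buffer_policy M L0 d A (ev A (\<lambda>_ _ _. k))"
proof (rule ev_policyI)
  fix t D and Q :: "nat list \<Rightarrow> 'a set list \<Rightarrow> bool"
  show "{\<omega> \<in> space M. Q (past t \<omega>) (map (\<lambda>u. ev A (\<lambda>_ _ _. k) u \<omega>) [0..<Suc t])} \<in> events \<and>
      prob {\<omega> \<in> space M. d t \<omega> \<in> D \<and> Q (past t \<omega>) (map (\<lambda>u. ev A (\<lambda>_ _ _. k) u \<omega>) [0..<Suc t])} =
      prob {\<omega> \<in> space M. d t \<omega> \<in> D} *
      prob {\<omega> \<in> space M. Q (past t \<omega>) (map (\<lambda>u. ev A (\<lambda>_ _ _. k) u \<omega>) [0..<Suc t])}"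
  proof (rule indep_vars_disjoint_functions[where X = d and I = UNIV and J = "{t}" and J' = "{..<t}"
        and h = "\<lambda>x. x t \<in> D"
        and h' = "\<lambda>x. Q (map x [0..<t]) (map (\<lambda>u. ev_buffer A (\<lambda>_ _. k) L0 x u) [0..<Suc t])"])
    fix x y :: "nat \<Rightarrow> nat"
    assume "\<And>j. j \<in> {..<t} \<Longrightarrow> x j = y j"
    then have "map x [0..<t] = map y [0..<t]"
      "map (\<lambda>u. ev_buffer A (\<lambda>_ _. k) L0 x u) [0..<Suc t] = map (\<lambda>u. ev_buffer A (\<lambda>_ _. k) L0 y u) [0..<Suc t]"
      by (auto simp del: upt_Suc intro!: ev_buffer_cong)
    then show "Q (map x [0..<t]) (map (\<lambda>u. ev_buffer A (\<lambda>_ _. k) L0 x u) [0..<Suc t]) \<longleftrightarrow>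
        Q (map y [0..<t]) (map (\<lambda>u. ev_buffer A (\<lambda>_ _. k) L0 y u) [0..<Suc t])"
      by argo
  qed (use depths in \<open>auto simp: lru_depths_def\<close>)
qed (use assms in auto)

section \<open>Randomized thresholds, one coin for each item and lifetime\<close>

lemma measurable_coin:
  assumes "lifetime_coins M L0 d \<gamma> k k' K" and "y \<in> set L0"
  shows "K y n \<in> M \<rightarrow>\<^sub>M count_space UNIV"
proof -
  have "Inr (y, n) \<in> UNIV <+> set L0 \<times> UNIV"
    using assms by auto
  then show ?thesis
    using assms unfolding lifetime_coins_def indep_vars_def by fastforce
qed

text \<open>Position \<open>j\<close> is depth \<open>j + 1\<close>, so this is the probability that
  the threshold still admits an item at position \<open>j\<close>.\<close>

lemma prob_coin:
  assumes "lifetime_coins M L0 d \<gamma> k k' K" and "y \<in> set L0" and "0 \<le> \<gamma>" "\<gamma> \<le> 1"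
  shows "prob {\<omega> \<in> space M. j < K y n \<omega>} = \<gamma> * (if j < k then 1 else 0) + (1 - \<gamma>) * (if j < k' then 1 else 0)"
proof -
  let ?f = "\<lambda>b. if b then k else k'"
  have distr: "distr M (count_space UNIV) (K y n) = measure_pmf (map_pmf ?f (bernoulli_pmf \<gamma>))"
    using assms by (simp add: lifetime_coins_def)
  have "prob {\<omega> \<in> space M. j < K y n \<omega>} = measure (distr M (count_space UNIV) (K y n)) {j<..}"
    using measurable_coin[OF assms(1,2)] by (subst measure_distr) (auto intro!: arg_cong[of _ _ prob])
  also have "\<dots> = measure_pmf.prob (bernoulli_pmf \<gamma>) {b. j < ?f b}"
    unfolding distr by (simp add: vimage_def)
  also have "\<dots> = (\<Sum>b | j < ?f b. pmf (bernoulli_pmf \<gamma>) b)"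
    by (rule measure_measure_pmf_finite) simp
  also have "\<dots> = (\<Sum>b\<in>UNIV. if j < ?f b then pmf (bernoulli_pmf \<gamma>) b else 0)"
    using sum.inter_filter[of UNIV "pmf (bernoulli_pmf \<gamma>)" "\<lambda>b. j < ?f b"] by simp
  also have "\<dots> = \<gamma> * (if j < k then 1 else 0) + (1 - \<gamma>) * (if j < k' then 1 else 0)"
    using assms by (simp add: UNIV_bool)
  finally show ?thesis .
qed

text \<open>Later, \<open>Q\<close> fixes which item is at a position and which lifetime it is in;
  the coin for that pair is independent of the past depths that decide this.\<close>

lemma coin_indep:
  assumes "lifetime_coins M L0 d \<gamma> k k' K" and "y \<in> set L0"
  shows "{\<omega> \<in> space M. Q (past t \<omega>)} \<in> events \<and> prob {\<omega> \<in> space M. j < K y n \<omega> \<and> Q (past t \<omega>)} =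
    prob {\<omega> \<in> space M. j < K y n \<omega>} * prob {\<omega> \<in> space M. Q (past t \<omega>)}"
proof -
  let ?X = "case_sum d (\<lambda>(y, n). K y n)"
  have "{\<omega> \<in> space M. Q (map (\<lambda>u. ?X (Inl u) \<omega>) [0..<t])} \<in> events \<and>
    prob {\<omega> \<in> space M. j < ?X (Inr (y, n)) \<omega> \<and> Q (map (\<lambda>u. ?X (Inl u) \<omega>) [0..<t])} =
    prob {\<omega> \<in> space M. j < ?X (Inr (y, n)) \<omega>} * prob {\<omega> \<in> space M. Q (map (\<lambda>u. ?X (Inl u) \<omega>) [0..<t])}"
  proof (rule indep_vars_disjoint_functions[where X = ?X and I = "UNIV <+> set L0 \<times> UNIV"
        and J = "{Inr (y, n)}" and J' = "Inl ` {..<t}"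
        and h = "\<lambda>x. j < x (Inr (y, n))" and h' = "\<lambda>x. Q (map (\<lambda>u. x (Inl u)) [0..<t])"])
    fix x x' :: "nat + 'a \<times> nat \<Rightarrow> nat"
    assume "\<And>j. j \<in> Inl ` {..<t} \<Longrightarrow> x j = x' j"
    then have "map (\<lambda>u. x (Inl u)) [0..<t] = map (\<lambda>u. x' (Inl u)) [0..<t]" by auto
    then show "Q (map (\<lambda>u. x (Inl u)) [0..<t]) \<longleftrightarrow> Q (map (\<lambda>u. x' (Inl u)) [0..<t])" by argo
  qed (use assms in \<open>auto simp: lifetime_coins_def\<close>)
  then show ?thesis by simp
qed

text \<open>The contents up to time \<open>t\<close> involve the depths before \<open>t\<close> and
  the coins with index at most \<open>t\<close>: finitely many coordinates, none of them the depth
  at \<open>t\<close>.\<close>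

lemma mixture_policy:
  assumes coins: "lifetime_coins M L0 d \<gamma> k k' K" and "0 < k" "0 < k'" "0 \<le> \<gamma>" "\<gamma> \<le> 1"
  shows "buffer_policy M L0 d (set L0) (ev (set L0) K)"
proof (rule ev_policyI)
  have "AE \<omega> in M. 0 < K y n \<omega>" if "y \<in> set L0" for y n
  proof -
    have "prob {\<omega> \<in> space M. 0 < K y n \<omega>} = 1"
      using prob_coin[OF coins that, of 0 n] assms by simp
    \<comment> \<open>A set that is not an event would have measure 0, so probability 1 also yields
      measurability.\<close>
    then show ?thesis
      using AE_in_set_eq_1[of "{\<omega> \<in> space M. 0 < K y n \<omega>}"] measure_notin_sets[of "{\<omega> \<in> space M. 0 < K y n \<omega>}" M]
      by (cases "{\<omega> \<in> space M. 0 < K y n \<omega>} \<in> events") (auto elim: eventually_mono)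
  qed
  then show "AE \<omega> in M. \<forall>y\<in>set L0. \<forall>n. 0 < K y n \<omega>"
    by (auto simp: AE_ball_countable AE_all_countable countable_finite)
next
  fix t D and Q :: "nat list \<Rightarrow> 'a set list \<Rightarrow> bool"
  let ?X = "case_sum d (\<lambda>(y, n). K y n)"
  let ?ev = "\<lambda>x :: nat + 'a \<times> nat \<Rightarrow> nat. ev_buffer (set L0) (\<lambda>y n. x (Inr (y, n))) L0 (\<lambda>u. x (Inl u))"
  let ?h' = "\<lambda>x :: nat + 'a \<times> nat \<Rightarrow> nat. Q (map (\<lambda>u. x (Inl u)) [0..<t]) (map (\<lambda>u. ?ev x u) [0..<Suc t])"
  have "{\<omega> \<in> space M. ?h' (\<lambda>j. ?X j \<omega>)} \<in> events \<and>
    prob {\<omega> \<in> space M. ?X (Inl t) \<omega> \<in> D \<and> ?h' (\<lambda>j. ?X j \<omega>)} =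
    prob {\<omega> \<in> space M. ?X (Inl t) \<omega> \<in> D} * prob {\<omega> \<in> space M. ?h' (\<lambda>j. ?X j \<omega>)}"
  proof (rule indep_vars_disjoint_functions[where X = ?X and I = "UNIV <+> set L0 \<times> UNIV"
        and J = "{Inl t}" and J' = "Inl ` {..<t} \<union> Inr ` (set L0 \<times> {..t})"
        and h = "\<lambda>x. x (Inl t) \<in> D" and h' = ?h'])
    fix x x' :: "nat + 'a \<times> nat \<Rightarrow> nat"
    assume "\<And>j. j \<in> Inl ` {..<t} \<union> Inr ` (set L0 \<times> {..t}) \<Longrightarrow> x j = x' j"
    then have "map (\<lambda>u. x (Inl u)) [0..<t] = map (\<lambda>u. x' (Inl u)) [0..<t]"
      "map (\<lambda>u. ?ev x u) [0..<Suc t] = map (\<lambda>u. ?ev x' u) [0..<Suc t]"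
      by (auto simp del: upt_Suc intro!: ev_buffer_cong)
    then show "?h' x \<longleftrightarrow> ?h' x'" by argo
  qed (use coins in \<open>auto simp: lifetime_coins_def\<close>)
  then show "{\<omega> \<in> space M. Q (past t \<omega>) (map (\<lambda>u. ev (set L0) K u \<omega>) [0..<Suc t])} \<in> events \<and>
      prob {\<omega> \<in> space M. d t \<omega> \<in> D \<and> Q (past t \<omega>) (map (\<lambda>u. ev (set L0) K u \<omega>) [0..<Suc t])} =
      prob {\<omega> \<in> space M. d t \<omega> \<in> D} *
      prob {\<omega> \<in> space M. Q (past t \<omega>) (map (\<lambda>u. ev (set L0) K u \<omega>) [0..<Suc t])}"
    by (simp del: upt_Suc)
qed

text \<open>The coin in force has a random index, namely the item at position \<open>j\<close> and
  its current lifetime. Both are determined by the past depths; on each such pair the item is kept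
  with probability \<open>r\<close> independently, and summing over the pairs leaves the accessed
  items of \<open>A\<close>.\<close>

lemma depth_prob_ev:
  assumes A: "A \<subseteq> set L0" and policy: "buffer_policy M L0 d A (ev A K)" and j: "j < V"
    and meas: "\<And>y n. y \<in> A \<Longrightarrow> {\<omega> \<in> space M. j < K y n \<omega>} \<in> events"
    and coins: "\<And>y n t Q. y \<in> A \<Longrightarrow> prob {\<omega> \<in> space M. j < K y n \<omega> \<and> Q (past t \<omega>)} =
      r * prob {\<omega> \<in> space M. Q (past t \<omega>)}"
  shows "depth_prob (ev A K) j t = r * (depth_prob (\<lambda>_ _. A) j t - depth_prob (unaccessed A) j t)"
proof -
  \<comment> \<open>Index 0 is left out because an item not accessed yet is not in the buffer; no
    index exceeds \<open>t\<close>.\<close>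
  let ?I = "A \<times> {1..t}"
  let ?Q = "\<lambda>(y, n) p. lru_stack L0 (nth p) t ! j = y \<and> lifetime L0 (nth p) t y = n"
  have fin: "finite ?I"
    using A finite_subset[of A "set L0"] by auto
  have Q: "{\<omega> \<in> space M. ?Q i (past t \<omega>)} \<in> events" for i
    using events_past[OF nonanticipating_const, where Q = "\<lambda>p _. ?Q i p"] .
  have index: "?Q i (past t \<omega>) \<longleftrightarrow> i = (stk t \<omega> ! j, lifetime L0 (\<lambda>u. d u \<omega>) t (stk t \<omega> ! j))" for i \<omega>
    by (cases i) (auto simp: stk_past lifetime_past)
  have KQ: "{\<omega> \<in> space M. j < K (fst i) (snd i) \<omega> \<and> ?Q i (past t \<omega>)} \<in> events" if "i \<in> ?I" for i
  proof -
    have "{\<omega> \<in> space M. j < K (fst i) (snd i) \<omega>} \<inter> {\<omega> \<in> space M. ?Q i (past t \<omega>)} \<in> events"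
      using that meas Q by (intro sets.Int) auto
    also have "{\<omega> \<in> space M. j < K (fst i) (snd i) \<omega>} \<inter> {\<omega> \<in> space M. ?Q i (past t \<omega>)} =
        {\<omega> \<in> space M. j < K (fst i) (snd i) \<omega> \<and> ?Q i (past t \<omega>)}" by auto
    finally show ?thesis .
  qed
  have "depth_prob (ev A K) j t = (\<Sum>i\<in>?I. prob {\<omega> \<in> space M. j < K (fst i) (snd i) \<omega> \<and> ?Q i (past t \<omega>)})"
    unfolding depth_prob_def
  proof (rule prob_sum[OF fin KQ])
    show "{\<omega> \<in> space M. stk t \<omega> ! j \<in> ev A K t \<omega>} \<in> events"
      using events_stack[OF nonanticipating_policy[OF policy], where R = "\<lambda>l b. l ! j \<in> b"] .
    show "AE \<omega> in M. (\<forall>i\<in>?I. j < K (fst i) (snd i) \<omega> \<and> ?Q i (past t \<omega>) \<longrightarrow> stk t \<omega> ! j \<in> ev A K t \<omega>) \<and>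
      (stk t \<omega> ! j \<in> ev A K t \<omega> \<longrightarrow> (\<exists>!i. i \<in> ?I \<and> j < K (fst i) (snd i) \<omega> \<and> ?Q i (past t \<omega>)))"
      using AE_depths
    proof eventually_elim
      case (elim \<omega>)
      let ?y = "stk t \<omega> ! j" and ?n = "lifetime L0 (\<lambda>u. d u \<omega>) t (stk t \<omega> ! j)"
      have "distinct (stk t \<omega>)" "length (stk t \<omega>) = V"
        using elim distinct_L0 by (auto simp: length_lru_stack distinct_lru_stack)
      then have "?y \<in> set (take k (stk t \<omega>)) \<longleftrightarrow> j < k" for k
        using j by (auto simp: in_set_conv_nth nth_eq_iff_index_eq)
      then have "?y \<in> ev A K t \<omega> \<longleftrightarrow> (?y, ?n) \<in> ?I \<and> j < K ?y ?n \<omega>"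
        using elim lifetime_le[of L0 "\<lambda>u. d u \<omega>" t ?y] by (subst mem_ev_buffer_iff) auto
      then show ?case
        unfolding index by auto
    qed
  qed
  also have "\<dots> = (\<Sum>i\<in>?I. r * prob {\<omega> \<in> space M. ?Q i (past t \<omega>)})"
    by (intro sum.cong refl coins) auto
  also have "(\<Sum>i\<in>?I. r * prob {\<omega> \<in> space M. ?Q i (past t \<omega>)}) =
      r * (\<Sum>i\<in>?I. prob {\<omega> \<in> space M. ?Q i (past t \<omega>)})"
    by (rule sum_distrib_left[symmetric])
  also have "(\<Sum>i\<in>?I. prob {\<omega> \<in> space M. ?Q i (past t \<omega>)}) = depth_prob (\<lambda>t \<omega>. A - unaccessed A t \<omega>) j t"
    unfolding depth_prob_def
  proof (rule prob_sum[OF fin Q, symmetric])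
    show "{\<omega> \<in> space M. stk t \<omega> ! j \<in> A - unaccessed A t \<omega>} \<in> events"
      using events_stack[OF nonanticipating_unaccessed, where R = "\<lambda>l b. l ! j \<in> A - b"] .
    have "stk t \<omega> ! j \<in> A - unaccessed A t \<omega> \<longleftrightarrow>
        (stk t \<omega> ! j, lifetime L0 (\<lambda>u. d u \<omega>) t (stk t \<omega> ! j)) \<in> ?I" for \<omega>
      using lifetime_le[of L0 "\<lambda>u. d u \<omega>" t "stk t \<omega> ! j"] by (auto simp: unaccessed_def)
    then show "AE \<omega> in M. (\<forall>i\<in>?I. ?Q i (past t \<omega>) \<longrightarrow> stk t \<omega> ! j \<in> A - unaccessed A t \<omega>) \<and>
      (stk t \<omega> ! j \<in> A - unaccessed A t \<omega> \<longrightarrow> (\<exists>!i. i \<in> ?I \<and> ?Q i (past t \<omega>)))"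
      unfolding index by (intro AE_I2) auto
  qed
  also have "\<dots> = depth_prob (\<lambda>_ _. A) j t - depth_prob (unaccessed A) j t"
    by (intro depth_prob_diff nonanticipating_unaccessed) (auto simp: unaccessed_def)
  finally show ?thesis .
qed

text \<open>An item of \<open>A\<close> at position \<open>j\<close> is kept with probability
  \<open>r j\<close>, whichever item it is. Items never accessed vanish in the average, so each
  limiting depth frequency is \<open>r j\<close> times that of \<open>A\<close>.\<close>

lemma ev_has_costs:
  assumes A: "A \<subseteq> set L0" and policy: "buffer_policy M L0 d A (ev A K)"
    and meas: "\<And>y n j. y \<in> A \<Longrightarrow> {\<omega> \<in> space M. j < K y n \<omega>} \<in> events"
    and coins: "\<And>y n t j Q. y \<in> A \<Longrightarrow> prob {\<omega> \<in> space M. j < K y n \<omega> \<and> Q (past t \<omega>)} =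
      r j * prob {\<omega> \<in> space M. Q (past t \<omega>)}"
  shows "has_costs M L0 d A (ev A K)
    (real (card A) / real V * (\<Sum>j<V. r j), real (card A) / real V * (1 - (\<Sum>j<V. pmf s (Suc j) * r j)))"
proof -
  let ?a = "real (card A) / real V"
  have "(\<lambda>T. total (ev A K) j T / real T) \<longlonglongrightarrow> r j * (?a - 0)" if j: "j < V" for j
  proof -
    have "total (ev A K) j T = r j * (total (\<lambda>_ _. A) j T - total (unaccessed A) j T)" for T
      using depth_prob_ev[OF A policy j meas coins]
      by (simp add: total_def sum_subtractf[symmetric] sum_distrib_left)
    moreover have "(\<lambda>T. r j * (total (\<lambda>_ _. A) j T / real T - total (unaccessed A) j T / real T)) \<longlonglongrightarrow>
        r j * (?a - 0)"
      by (intro tendsto_mult tendsto_diff tendsto_const avg_total_const avg_total_unaccessed A j)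
    ultimately show ?thesis
      by (simp add: diff_divide_distrib right_diff_distrib)
  qed
  from has_costs_if_avg_total[OF A policy this]
  have "has_costs M L0 d A (ev A K) (\<Sum>j<V. r j * (?a - 0), \<Sum>j<V. pmf s (Suc j) * (?a - r j * (?a - 0)))" .
  also have "(\<Sum>j<V. r j * (?a - 0)) = ?a * (\<Sum>j<V. r j)"
    by (simp only: diff_0_right sum_distrib_right[symmetric] mult.commute)
  also have "(\<Sum>j<V. pmf s (Suc j) * (?a - r j * (?a - 0))) = ?a * (\<Sum>j<V. pmf s (Suc j) - pmf s (Suc j) * r j)"
    unfolding sum_distrib_left by (intro sum.cong refl) (simp add: algebra_simps)
  also have "(\<Sum>j<V. pmf s (Suc j) - pmf s (Suc j) * r j) = 1 - (\<Sum>j<V. pmf s (Suc j) * r j)"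
    using S_V by (simp add: S_sum sum_subtractf)
  finally show ?thesis .
qed

lemma ev_const_costs:
  assumes "A \<subseteq> set L0" and k: "k \<in> {1..V}"
  shows "has_costs M L0 d A (ev A (\<lambda>_ _ _. k))
    (real (card A) / real V * real k, real (card A) / real V * (1 - S k))"
proof -
  have "has_costs M L0 d A (ev A (\<lambda>_ _ _. k)) (real (card A) / real V * (\<Sum>j<V. 1 * (if j < k then 1 else 0)),
    real (card A) / real V * (1 - (\<Sum>j<V. pmf s (Suc j) * (if j < k then 1 else 0))))"
    unfolding mult_1_left
    using k by (intro ev_has_costs assms ev_const_policy) auto
  then show ?thesis
    using k by (subst (asm) (1 2) sum_threshold) (auto simp: S_sum)
qed

text \<open>Both costs are affine in the retention probabilities, so those of the mixture
  interpolate those of the two thresholds.\<close>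

lemma mixture_costs:
  assumes coins: "lifetime_coins M L0 d \<gamma> k k' K" and k: "k \<in> {1..V}" "k' \<in> {1..V}" and \<gamma>: "0 \<le> \<gamma>" "\<gamma> \<le> 1"
  shows "has_costs M L0 d (set L0) (ev (set L0) K)
    (\<gamma> * real k + (1 - \<gamma>) * real k', 1 - (\<gamma> * S k + (1 - \<gamma>) * S k'))"
proof -
  let ?r = "\<lambda>j. \<gamma> * (if j < k then 1 else 0) + (1 - \<gamma>) * (if j < k' then 1 else 0) :: real"
  have "has_costs M L0 d (set L0) (ev (set L0) K) (real (card (set L0)) / real V * (\<Sum>j<V. ?r j),
    real (card (set L0)) / real V * (1 - (\<Sum>j<V. pmf s (Suc j) * ?r j)))"
  proof (rule ev_has_costs)
    fix y and n j :: nat assume y: "y \<in> set L0"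
    from measurable_sets[OF measurable_coin[OF coins y], of "{j<..}"]
    show "{\<omega> \<in> space M. j < K y n \<omega>} \<in> events"
      by (simp add: vimage_def Int_def conj_commute)
    show "prob {\<omega> \<in> space M. j < K y n \<omega> \<and> Q (past t \<omega>)} = ?r j * prob {\<omega> \<in> space M. Q (past t \<omega>)}" for Q t
      using coin_indep[OF coins y, of Q t j n] prob_coin[OF coins y \<gamma>, of j n] by simp
  qed (use mixture_policy[OF coins] k \<gamma> in auto)
  also have "real (card (set L0)) / real V = 1"
    using V_pos distinct_L0 by (simp add: distinct_card)
  also have "(\<Sum>j<V. ?r j) = \<gamma> * (\<Sum>j<V. 1 * (if j < k then 1 else 0)) + (1 - \<gamma>) * (\<Sum>j<V. 1 * (if j < k' then 1 else 0))"
    unfolding mult_1_left by (simp only: sum.distrib sum_distrib_left)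
  also have "(\<Sum>j<V. pmf s (Suc j) * ?r j) = \<gamma> * (\<Sum>j<V. pmf s (Suc j) * (if j < k then 1 else 0)) +
      (1 - \<gamma>) * (\<Sum>j<V. pmf s (Suc j) * (if j < k' then 1 else 0))"
    unfolding sum_distrib_left sum.distrib[symmetric] by (intro sum.cong refl) (simp add: algebra_simps)
  finally show ?thesis
    using k by (simp only: sum_threshold atLeastAtMost_iff) (simp add: S_sum)
qed

subsection \<open>Supported efficient thresholds\<close>

text \<open>The Lagrangian bound for one item, which receives the share \<open>1 / V\<close> of all
  accesses: a line with slope \<open>-\<mu>\<close> below all attainable cost pairs.\<close>

lemma single_item_cost_lower_bound:
  assumes x: "x \<in> set L0" and c: "c \<in> single_item_costs M L0 d x"
    and F: "\<And>k. k \<in> {1..V} \<Longrightarrow> S k - \<mu> * real k \<le> F"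
  shows "(1 - F) / real V \<le> snd c + \<mu> * fst c"
proof -
  obtain B where B: "buffer_policy M L0 d {x} B" "avg_occupancy M B \<longlonglongrightarrow> fst c"
    "avg_misses M L0 d {x} B \<longlonglongrightarrow> snd c"
    using c by (auto simp: single_item_costs_def has_costs_def)
  obtain g where g: "\<And>T. 0 < T \<Longrightarrow> g T \<le> avg_misses M L0 d {x} B T"
    "g \<longlonglongrightarrow> real (card {x}) / real V * (1 - F) - \<mu> * fst c"
    using policy_lower_bound[OF _ B(1,2) F] x by auto
  have "real (card {x}) / real V * (1 - F) - \<mu> * fst c \<le> snd c"
    using g(2) B(3)
    by (rule LIMSEQ_le) (use g(1) in \<open>auto intro!: exI[of _ 1]\<close>)
  then show ?thesis
    by simp
qed

abbreviation ev_cost :: "nat \<Rightarrow> real \<times> real" where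
  "ev_cost k \<equiv> (real k / real V, (1 - S k) / real V)"

lemma ev_cost:
  assumes "x \<in> set L0" "k \<in> {1..V}"
  shows "has_costs M L0 d {x} (ev {x} (\<lambda>_ _ _. k)) (ev_cost k)"
    and "ev_cost k \<in> single_item_costs M L0 d x"
proof -
  show "has_costs M L0 d {x} (ev {x} (\<lambda>_ _ _. k)) (ev_cost k)"
    using ev_const_costs[of "{x}" k] assms by simp
  moreover have "buffer_policy M L0 d {x} (ev {x} (\<lambda>_ _ _. k))"
    using assms by (intro ev_const_policy) auto
  ultimately show "ev_cost k \<in> single_item_costs M L0 d x"
    unfolding single_item_costs_def by blast
qed

text \<open>Each slope at which \<open>k\<close> is a maximiser gives a line through
  \<open>ev_cost k\<close> below all attainable cost pairs. Slopes are nonnegative because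
  domination means being at most as large in both costs.\<close>

lemma supported_efficientI:
  assumes k: "k \<in> {1..V}" and \<mu>: "0 \<le> \<mu>" "\<mu> < \<mu>'"
    and max: "\<And>j. j \<in> {1..V} \<Longrightarrow> S j - \<mu> * real j \<le> S k - \<mu> * real k"
      "\<And>j. j \<in> {1..V} \<Longrightarrow> S j - \<mu>' * real j \<le> S k - \<mu>' * real k"
  shows "supported_efficient M L0 d k"
  unfolding supported_efficient_def
proof
  fix x assume x: "x \<in> set L0"
  have line: "snd (ev_cost k) + \<nu> * fst (ev_cost k) \<le> snd p + \<nu> * fst p"
    if "p \<in> single_item_costs M L0 d x" "\<And>j. j \<in> {1..V} \<Longrightarrow> S j - \<nu> * real j \<le> S k - \<nu> * real k" for p \<nu>
    using single_item_cost_lower_bound[OF x that(1), of \<nu> "S k - \<nu> * real k"] that(2)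
    by (simp add: diff_divide_distrib)
  have "\<not> (\<exists>p \<in> convex hull (single_item_costs M L0 d x - {ev_cost k}).
      fst p \<le> fst (ev_cost k) \<and> snd p \<le> snd (ev_cost k))"
    using \<mu> max by (intro not_dominated_if_two_supporting_lines[of \<mu> \<mu>'] line) auto
  then show "\<exists>c. has_costs M L0 d {x} (ev {x} (\<lambda>_ _ _. k)) c \<and>
      \<not> (\<exists>p \<in> convex hull (single_item_costs M L0 d x - {c}). fst p \<le> fst c \<and> snd p \<le> snd c)"
    using ev_cost(1)[OF x k] by blast
qed

text \<open>If the chord passed above \<open>a\<close>, mixing the thresholds \<open>i\<close> and
  \<open>j\<close> with mean \<open>a\<close> would give the same occupancy and no more misses. The
  inequality is cleared of denominators.\<close>

lemma supported_efficient_above_chord: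
  assumes sup: "supported_efficient M L0 d a" and ij: "i \<in> {1..V}" "j \<in> {1..V}" "i < a" "a < j"
  shows "(real j - real a) * S i + (real a - real i) * S j \<le> (real j - real i) * S a"
proof (rule ccontr)
  assume "\<not> ?thesis"
  then have less: "(real j - real i) * S a < (real j - real a) * S i + (real a - real i) * S j"
    by simp
  obtain x where x: "x \<in> set L0"
    using V_pos by (cases L0) auto
  have a: "a \<in> {1..V}"
    using ij by auto
  obtain c where c: "has_costs M L0 d {x} (ev {x} (\<lambda>_ _ _. a)) c"
    "\<not> (\<exists>p \<in> convex hull (single_item_costs M L0 d x - {c}). fst p \<le> fst c \<and> snd p \<le> snd c)"
    using sup x unfolding supported_efficient_def by blast
  have "c = ev_cost a"
    using c(1) ev_cost(1)[OF x a] unfolding has_costs_def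
    by (auto simp: prod_eq_iff dest: LIMSEQ_unique)
  \<comment> \<open>The barycentric weights of \<open>a\<close> between \<open>i\<close> and
    \<open>j\<close>, so that the occupancies match exactly.\<close>
  define u where "u = (real j - real a) / (real j - real i)"
  define v where "v = (real a - real i) / (real j - real i)"
  let ?p = "u *\<^sub>R ev_cost i + v *\<^sub>R ev_cost j"
  have uv: "0 \<le> u" "0 \<le> v" "u + v = 1"
    using ij by (auto simp: u_def v_def add_divide_distrib[symmetric])
  \<comment> \<open>Both pairs differ from \<open>c\<close> in occupancy, so they survive its
    removal.\<close>
  have "ev_cost i \<in> single_item_costs M L0 d x - {c}" "ev_cost j \<in> single_item_costs M L0 d x - {c}"
    using ev_cost(2)[OF x] ij V_pos \<open>c = ev_cost a\<close> by auto
  then have "?p \<in> convex hull (single_item_costs M L0 d x - {c})"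
    using uv by (intro convexD[OF convex_convex_hull] hull_inc) auto
  moreover have "u * real i + v * real j = real a"
    using ij by (simp add: u_def v_def divide_simps) (simp add: algebra_simps)
  then have "fst ?p = fst c"
    unfolding \<open>c = ev_cost a\<close> by (simp add: add_divide_distrib[symmetric])
  moreover have "u * S i + v * S j = ((real j - real a) * S i + (real a - real i) * S j) / (real j - real i)"
    by (simp add: u_def v_def add_divide_distrib)
  then have "S a \<le> u * S i + v * S j"
    using less ij by (simp add: pos_le_divide_eq mult.commute)
  then have "u * (1 - S i) + v * (1 - S j) \<le> 1 - S a"
    using uv(3) by (simp add: algebra_simps)
  then have "snd ?p \<le> snd c"
    unfolding \<open>c = ev_cost a\<close> by (simp add: add_divide_distrib[symmetric] divide_right_mono)
  ultimately show False
    using c(2) by auto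
qed

lemma S_mono: "i \<le> j \<Longrightarrow> S i \<le> S j"
  by (intro measure_pmf.finite_measure_mono) auto

text \<open>Any slope of at least 1 works: moving from 1 to a larger \<open>j\<close> gains at most
  1 in \<open>S\<close> and costs at least the slope.\<close>

lemma supported_efficient_1: "supported_efficient M L0 d 1"
proof (rule supported_efficientI[of _ 1 2])
  have "S j - S 1 \<le> \<mu> * (real j - 1)" if "j \<in> {1..V}" "1 \<le> \<mu>" for j \<mu>
  proof (cases "j = 1")
    case False
    then have "1 * 1 \<le> \<mu> * (real j - 1)"
      using that by (intro mult_mono) auto
    moreover have "S j \<le> 1" "0 \<le> S 1"
      by auto
    ultimately show ?thesis
      by linarith
  qed simp
  from this[of _ 1] this[of _ 2] show "S j - 1 * real j \<le> S 1 - 1 * real 1" "S j - 2 * real j \<le> S 1 - 2 * real 1"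
    if "j \<in> {1..V}" for j
    using that by (fastforce simp: algebra_simps)+
  show "1 \<in> {1..V}"
    using V_pos by (simp only: atLeastAtMost_iff One_nat_def Suc_le_eq order_refl)
qed auto

text \<open>Slope 0 works because \<open>S V = 1\<close>. The slope \<open>pmf s V / real V\<close>
  also works: at \<open>V\<close> it costs \<open>pmf s V\<close> in all, no more than the amount by
  which \<open>S\<close> falls short of 1 at any smaller depth.\<close>

lemma supported_efficient_V: "supported_efficient M L0 d V"
proof (rule supported_efficientI[of _ 0 "pmf s V / real V"])
  show "S j - 0 * real j \<le> S V - 0 * real V" for j
    by (simp add: S_V)
  show "S j - pmf s V / real V * real j \<le> S V - pmf s V / real V * real V" if "j \<in> {1..V}" for j
  proof (cases "j = V")
    case False
    then have "S j + pmf s V \<le> 1"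
      using that by (intro S_gap) auto
    moreover have "0 \<le> pmf s V / real V * real j"
      by simp
    moreover have "pmf s V / real V * real V = pmf s V"
      using V_pos by simp
    ultimately show ?thesis
      using S_V by linarith
  qed simp
  show "V \<in> {1..V}"
    using V_pos by (simp only: atLeastAtMost_iff One_nat_def Suc_le_eq order_refl)
qed (use V_pos pmf_last_pos in auto)

text \<open>
  If some \<open>k\<close> lay above the line through the points of \<open>a\<close> and \<open>b\<close>, take the leftmost one that is
  highest above it: outside of \<open>[a, b]\<close> it makes \<open>a\<close> or \<open>b\<close> lie below a chord, and inside it is
  supported efficient, since the slope can be increased slightly.
\<close>

lemma consecutive_supporting_line:
  assumes ab: "a \<in> {1..V}" "b \<in> {1..V}" "a < b"
    and sup: "supported_efficient M L0 d a" "supported_efficient M L0 d b"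
    and consecutive: "\<And>k. a < k \<Longrightarrow> k < b \<Longrightarrow> \<not> supported_efficient M L0 d k"
    and \<mu>: "S b - S a = \<mu> * (real b - real a)" and j: "j \<in> {1..V}"
  shows "S j - \<mu> * real j \<le> S a - \<mu> * real a"
proof (rule ccontr)
  define F where "F k = S k - \<mu> * real k" for k
  assume "\<not> ?thesis"
  then have "F a < F j"
    by (simp add: F_def)
  have Fab: "F a = F b"
    using \<mu> by (simp add: F_def algebra_simps)
  define m where "m = Max (F ` {1..V})"
  define k where "k = Min {k \<in> {1..V}. F k = m}"
  have F_le: "F i \<le> m" if "i \<in> {1..V}" for i
    using that unfolding m_def by (intro Max_ge) auto
  have "m \<in> F ` {1..V}"
    unfolding m_def using j by (intro Max_in) auto
  then have "k \<in> {k \<in> {1..V}. F k = m}"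
    unfolding k_def by (intro Min_in) auto
  then have k: "k \<in> {1..V}" "F k = m"
    by auto
  have F_less: "F i < F k" if "i \<in> {1..V}" "i < k" for i
  proof -
    have "F i \<noteq> m"
      using that Min_le[of "{k \<in> {1..V}. F k = m}" i] unfolding k_def by fastforce
    then show ?thesis
      using F_le[OF that(1)] k(2) by simp
  qed
  have Fak: "F a < F k"
    using \<open>F a < F j\<close> F_le[OF j] k(2) by simp
  have S_F: "S i = F i + \<mu> * real i" for i
    by (simp add: F_def)
  consider "k < a" | "a < k" "k < b" | "b < k"
    using Fak Fab by fastforce
  then show False
  proof cases
    case 1
    have "(real b - real a) * S k + (real a - real k) * S b \<le> (real b - real k) * S a"
      using supported_efficient_above_chord[OF sup(1) k(1) ab(2) 1 ab(3)] .
    then have "(real b - real a) * F k \<le> (real b - real a) * F a"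
      unfolding S_F Fab by (simp add: algebra_simps)
    then show False
      using Fak ab by simp
  next
    case 3
    have "(real k - real b) * S a + (real b - real a) * S k \<le> (real k - real a) * S b"
      using supported_efficient_above_chord[OF sup(2) ab(1) k(1) ab(3) 3] .
    then have "(real b - real a) * F k \<le> (real b - real a) * F a"
      unfolding S_F Fab by (simp add: algebra_simps)
    then show False
      using Fak ab by simp
  next
    case 2
    \<comment> \<open>The increase of the slope: every \<open>F i\<close> with \<open>i < k\<close>
      lies at least \<open>e * real V\<close> below \<open>F k\<close>, while \<open>k - i\<close>
      is at most \<open>V\<close>. Inserting 1 makes the minimum one over a nonempty set.\<close>
    define e where "e = Min (insert 1 ((\<lambda>i. (F k - F i) / real V) ` {1..<k}))"
    have "0 < e"
      unfolding e_def using F_less k V_pos by (subst Min_gr_iff) auto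
    have e: "e * real V \<le> F k - F i" if "i \<in> {1..<k}" for i
    proof -
      have "e \<le> (F k - F i) / real V"
        unfolding e_def using that by (intro Min_le) auto
      then show ?thesis
        using V_pos by (simp add: pos_le_divide_eq)
    qed
    have "0 \<le> \<mu> * (real b - real a)"
      using S_mono[of a b] \<mu> ab by linarith
    then have "0 \<le> \<mu>"
      using ab by (simp add: zero_le_mult_iff)
    have "supported_efficient M L0 d k"
    proof (rule supported_efficientI[OF k(1) \<open>0 \<le> \<mu>\<close>])
      show "\<mu> < \<mu> + e"
        using \<open>0 < e\<close> by simp
      show "S i - \<mu> * real i \<le> S k - \<mu> * real k" if "i \<in> {1..V}" for i
        using F_le[OF that] k(2) by (simp add: F_def)
      show "S i - (\<mu> + e) * real i \<le> S k - (\<mu> + e) * real k" if i: "i \<in> {1..V}" for i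
      proof -
        have "e * (real k - real i) \<le> F k - F i"
        proof (cases "i < k")
          case True
          have "e * (real k - real i) \<le> e * real V"
            using \<open>0 < e\<close> k by (intro mult_left_mono) auto
          also have "\<dots> \<le> F k - F i"
            using e i True by auto
          finally show ?thesis .
        next
          case False
          \<comment> \<open>At \<open>k\<close> and to its right, a larger slope can only favour
            \<open>k\<close>.\<close>
          then have "e * (real k - real i) \<le> 0"
            using \<open>0 < e\<close> by (intro mult_nonneg_nonpos) auto
          then show ?thesis
            using F_le[OF i] k(2) by simp
        qed
        then show ?thesis
          by (simp add: F_def algebra_simps)
      qed
    qed
    then show False
      using consecutive 2 by blast
  qed
qed

end

text \<open>A competing policy is only assumed to have a limiting occupancy; its miss averages may
  oscillate, so they are compared through \<open>liminf\<close>.\<close>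

theorem theorem2:
  fixes M :: "'w measure" and V :: nat and s :: "nat pmf"
    and L0 :: "'a list" and d :: "nat \<Rightarrow> 'w \<Rightarrow> nat"
    and q :: "nat \<Rightarrow> nat" and l i :: nat and C \<gamma> :: real
    and K :: "'a \<Rightarrow> nat \<Rightarrow> 'w \<Rightarrow> nat"
  assumes "prob_space M"
    and "V \<ge> 2" and "set_pmf s \<subseteq> {1..V}" and "pmf s V > 0"
    and "distinct L0" and "length L0 = V"
    and "lru_depths M s d"
    and "strict_mono_on {1..l} q"
    and "q ` {1..l} = {k \<in> {1..V}. supported_efficient M L0 d k}"
    and "1 \<le> i" and "i < l"
    and "real (q i) < C" and "C \<le> real (q (i + 1))"
    and "0 \<le> \<gamma>" and "\<gamma> < 1"
    and "C = \<gamma> * real (q i) + (1 - \<gamma>) * real (q (i + 1))"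
    and "lifetime_coins M L0 d \<gamma> (q i) (q (i + 1)) K"
  shows "q 1 = 1 \<and> q l = V \<and>
    buffer_policy M L0 d (set L0) (mixture_buffer L0 d K) \<and>
    (\<exists>m. has_costs M L0 d (set L0) (mixture_buffer L0 d K) (C, m) \<and>
       (\<forall>B. buffer_policy M L0 d (set L0) B \<longrightarrow> avg_occupancy M B \<longlonglongrightarrow> C \<longrightarrow>
          ereal m \<le> liminf (\<lambda>T. ereal (avg_misses M L0 d (set L0) B T))))"
proof -
  note q_mono = \<open>strict_mono_on {1..l} q\<close> and q_image = \<open>q ` {1..l} = _\<close>
    and coins = \<open>lifetime_coins M L0 d \<gamma> (q i) (q (i + 1)) K\<close>
  interpret lru_model M s L0 d
    using assms by (auto simp: lru_model_def lru_model_axioms_def)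
  have V: "V = length L0"
    using assms by simp
  have q_less: "q j < q j' \<longleftrightarrow> j < j'" if "j \<in> {1..l}" "j' \<in> {1..l}" for j j'
    using strict_mono_on_less[OF q_mono] that by blast
  have q_mem: "q j \<in> {1..V}" "supported_efficient M L0 d (q j)" if "j \<in> {1..l}" for j
    using q_image that by blast+
  have q_surj: "\<exists>j\<in>{1..l}. q j = k" if "k \<in> {1..V}" "supported_efficient M L0 d k" for k
    using q_image that by (metis (mono_tags, lifting) image_iff mem_Collect_eq)
  have i: "i \<in> {1..l}" "i + 1 \<in> {1..l}" "1 \<in> {1..l}" "l \<in> {1..l}"
    using \<open>1 \<le> i\<close> \<open>i < l\<close> by auto
  obtain j where j: "j \<in> {1..l}" "q j = 1"
    using q_surj[OF _ supported_efficient_1] \<open>V \<ge> 2\<close> by auto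
  have "q 1 = 1"
    using q_less[OF i(3) j(1)] q_mem(1)[OF i(3)] j by (cases "j = 1") auto
  moreover
  obtain j' where j': "j' \<in> {1..l}" "q j' = V"
    using q_surj[of V] supported_efficient_V \<open>V \<ge> 2\<close> V by auto
  have "q l = V"
    using q_less[OF j'(1) i(4)] q_mem(1)[OF i(4)] j' by (cases "j' = l") auto
  moreover
  let ?a = "q i" and ?b = "q (i + 1)"
  have ab: "?a \<in> {1..V}" "?b \<in> {1..V}" "?a < ?b"
    using q_mem(1) q_less i by auto
  have mix: "mixture_buffer L0 d K = ev (set L0) K"
    by (simp add: mixture_buffer_def fun_eq_iff)
  have "buffer_policy M L0 d (set L0) (mixture_buffer L0 d K)"
    unfolding mix using ab assms by (intro mixture_policy[OF coins]) auto
  moreover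
  define m where "m = 1 - (\<gamma> * S ?a + (1 - \<gamma>) * S ?b)"
  have "has_costs M L0 d (set L0) (mixture_buffer L0 d K) (C, m)"
    unfolding mix m_def \<open>C = _\<close> using ab assms by (intro mixture_costs[OF coins]) auto
  moreover
  \<comment> \<open>The slope of the chord between the two consecutive efficient thresholds; it is
    the multiplier for the occupancy constraint.\<close>
  define \<mu> where "\<mu> = (S ?b - S ?a) / (real ?b - real ?a)"
  have \<mu>: "S ?b - S ?a = \<mu> * (real ?b - real ?a)"
    using ab by (simp add: \<mu>_def)
  have line: "S k - \<mu> * real k \<le> S ?a - \<mu> * real ?a" if "k \<in> {1..length L0}" for k
  proof (rule consecutive_supporting_line)
    fix k' assume k': "?a < k'" "k' < ?b"
    show "\<not> supported_efficient M L0 d k'"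
    proof
      assume "supported_efficient M L0 d k'"
      then obtain j where "j \<in> {1..l}" "q j = k'"
        using q_surj[of k'] k' ab by auto
      then show False
        using k' q_less[OF i(1), of j] q_less[OF _ i(2), of j] by auto
    qed
  qed (use ab q_mem(2) i \<mu> V that in auto)
  have "ereal m \<le> liminf (\<lambda>T. ereal (avg_misses M L0 d (set L0) B T))"
    if B: "buffer_policy M L0 d (set L0) B" "avg_occupancy M B \<longlonglongrightarrow> C" for B
  proof -
    obtain g where g: "\<And>T. 0 < T \<Longrightarrow> g T \<le> avg_misses M L0 d (set L0) B T"
      "g \<longlonglongrightarrow> real (card (set L0)) / real (length L0) * (1 - (S ?a - \<mu> * real ?a)) - \<mu> * C"
      using policy_lower_bound[OF subset_refl B line] by blast
    have card: "real (card (set L0)) / real (length L0) = 1"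
      using V_pos distinct_L0 by (simp add: distinct_card)
    have S_b: "S ?b = S ?a + \<mu> * (real ?b - real ?a)"
      using \<mu> by simp
    \<comment> \<open>Both thresholds lie on the supporting line, so at occupancy \<open>C\<close>
      its bound is the miss rate of the mixture.\<close>
    have "real (card (set L0)) / real (length L0) * (1 - (S ?a - \<mu> * real ?a)) - \<mu> * C = m"
      unfolding m_def \<open>C = _\<close> card S_b by (simp add: algebra_simps)
    then have "(\<lambda>T. ereal (g T)) \<longlonglongrightarrow> ereal m"
      using g(2) by simp
    then have "ereal m = liminf (\<lambda>T. ereal (g T))"
      by (intro lim_imp_Liminf[symmetric]) auto
    also have "\<dots> \<le> liminf (\<lambda>T. ereal (avg_misses M L0 d (set L0) B T))"
      using g(1) by (intro Liminf_mono eventually_sequentiallyI[of 1]) auto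
    finally show ?thesis .
  qed
  ultimately show ?thesis
    by blast
qed

end
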